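(* Let $i\ge2$ be an integer. The map $[0,\pi/2]\ni\alpha\mapsto\mathcal{F}^{[i]}_\alpha$, with values in the space of nonempty compact subsets of $\mathbb{R}^2$ equipped with the Hausdorff metric, is continuous from above at $\alpha=0$. That is, the Hausdorff distance between $\mathcal{F}^{[i]}_\alpha$ and $\mathcal{F}^{[i]}_0$ tends to $0$ as $\alpha\to0^+$.
   Context: For an integer $i\ge2$, the $i$-Fibonacci words over $\{0,1\}$ are defined by $f^{[i]}_1=0$, $f^{[i]}_2=0^{i-1}1$ (where $0^{i-1}$ denotes $i-1$ zeros), and $f^{[i]}_n=f^{[i]}_{n-1}f^{[i]}_{n-2}$ for $n\ge3$. Drawing rule with drawing angle $\alpha$: given a word $a_1\cdots a_N$, start at the origin with current direction $\theta=\pi/2$. For $j=1,\dots,N$, first draw a unit segment from the current point in direction $\theta$ and move the current point to its endpoint. Then update the direction: if $a_j=0$ and $j$ is even, $\theta\mapsto\theta+\alpha$; if $a_j=0$ and $j$ is odd, $\theta\mapsto\theta-\alpha$; if $a_j=1$, $\theta$ is unchanged. $\mathcal{F}^{[i]}_n$ is the union of the segments drawn for $f^{[i]}_n$, and $w^{[i]}_n$ is the distance between its first vertex (the origin) and its last vertex. Let $m(k)=6k+5$ if $i$ is even and $m(k)=6k+3$ if $i$ is odd. For $\alpha\in(0,\pi/2]$, the Fibonacci fractal $\mathcal{F}^{[i]}_\alpha$ is the limit, in the Hausdorff metric, of $\frac{\sqrt2}{w^{[i]}_{m(k)}}\mathcal{F}^{[i]}_{m(k)}$ (dilation about the origin)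 as $k\to\infty$; this limit exists. For $\alpha=0$ all curves are vertical segments starting at the origin, and $\mathcal{F}^{[i]}_0$ is the segment from $(0,0)$ to $(0,\sqrt2)$. The Hausdorff metric between nonempty compact sets $U,V\subset\mathbb{R}^2$ is the standard one, $\max\{\sup_{x\in U}\operatorname{dist}(x,V),\sup_{y\in V}\operatorname{dist}(y,U)\}$ (or an equivalent variant). *)

theory Defs
  imports "HOL-Analysis.Analysis"
begin

text \<open>The i-Fibonacci words over {0,1}, as lists of naturals; index n \<ge> 1
  as in the paper (the value at n = 0 is irrelevant).\<close>
fun fibw :: "nat \<Rightarrow> nat \<Rightarrow> nat list" where
  "fibw i 0 = []"
| "fibw i (Suc 0) = [0]"
| "fibw i (Suc (Suc 0)) = replicate (i - 1) 0 @ [1]"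
| "fibw i (Suc (Suc (Suc n))) = fibw i (Suc (Suc n)) @ fibw i (Suc n)"

text \<open>Direction change after the letter at 0-based position k (= position j = k+1
  of the paper): a 0 at an even position j turns by +alpha, at an odd j by -alpha.\<close>
definition turn :: "nat list \<Rightarrow> real \<Rightarrow> nat \<Rightarrow> real" where
  "turn w \<alpha> k = (if w ! k = 0 then (if even (Suc k) then \<alpha> else - \<alpha>) else 0)"

definition dir :: "nat list \<Rightarrow> real \<Rightarrow> nat \<Rightarrow> real" where
  "dir w \<alpha> k = pi / 2 + (\<Sum>l<k. turn w \<alpha> l)"

definition vertex :: "nat list \<Rightarrow> real \<Rightarrow> nat \<Rightarrow> real \<times> real" where
  "vertex w \<alpha> k = (\<Sum>l<k. (cos (dir w \<alpha> l), sin (dir w \<alpha> l)))"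

definition curve :: "nat list \<Rightarrow> real \<Rightarrow> (real \<times> real) set" where
  "curve w \<alpha> = (\<Union>k<length w. closed_segment (vertex w \<alpha> k) (vertex w \<alpha> (Suc k)))"

definition endlen :: "nat list \<Rightarrow> real \<Rightarrow> real" where
  "endlen w \<alpha> = dist (0,0) (vertex w \<alpha> (length w))"

definition mk :: "nat \<Rightarrow> nat \<Rightarrow> nat" where
  "mk i k = (if even i then 6 * k + 5 else 6 * k + 3)"

definition hausdist :: "(real \<times> real) set \<Rightarrow> (real \<times> real) set \<Rightarrow> real" where
  "hausdist U V = max (SUP x\<in>U. infdist x V) (SUP y\<in>V. infdist y U)"

definition scaled_curve :: "nat \<Rightarrow> real \<Rightarrow> nat \<Rightarrow> (real \<times> real) set" where
  "scaled_curve i \<alpha> n =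
     (\<lambda>x. (sqrt 2 / endlen (fibw i n) \<alpha>) *\<^sub>R x) ` curve (fibw i n) \<alpha>"

text \<open>The Fibonacci fractal: for alpha = 0 the vertical segment, otherwise the
  Hausdorff limit of the rescaled curves along m(k) (which exists by the paper).\<close>
definition fib_fractal :: "nat \<Rightarrow> real \<Rightarrow> (real \<times> real) set" where
  "fib_fractal i \<alpha> =
     (if \<alpha> = 0 then closed_segment (0,0) (0, sqrt 2)
      else (THE K. compact K \<and> K \<noteq> {} \<and>
              (\<lambda>k. hausdist (scaled_curve i \<alpha> (mk i k)) K) \<longlonglongrightarrow> 0))"

end

theory Submission
  imports Defs
begin

text \<open>
  Write \<open>X\<^sub>k = f\<^sub>n\<close> and \<open>Y\<^sub>k = f\<^sub>n\<^sub>-\<^sub>1\<close> with \<open>n = E + 3k\<close>, where \<open>E = 5\<close> for even \<open>i\<close> and \<open>E = 3\<close> for odd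
  \<open>i\<close>, so that \<open>X\<^sub>k\<close> has even and \<open>Y\<^sub>k\<close> odd length. Three Fibonacci steps give \<open>X' = X Y X X Y\<close> and
  \<open>Y' = X Y X\<close>; the total turning of \<open>X\<^sub>k\<close> is \<open>(-1)\<^sup>k\<close> and that of \<open>Y\<^sub>k\<close> is constant. Reflecting
  every second generation therefore turns the pair of curves into an autonomous graph-directed
  system. The pair of end points obeys a real linear recurrence with characteristic polynomial
  \<open>(x\<^sup>2 - (2 + 2 cos \<alpha>) x - 1) (x\<^sup>2 - 1)\<close>; after division by the \<open>k\<close>-th power of its dominant root
  \<open>growth \<alpha>\<close>, the end points converge geometrically, and their limit depends continuously on \<open>\<alpha>\<close>.

  The system contracts Hausdorff distances by \<open>1 / growth \<alpha> \<le> 1/2\<close> up to the error in the end points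
  and coefficients. Comparing consecutive generations shows that the rescaled curves form a Cauchy
  sequence, so the fractal exists; comparing the systems for \<open>\<alpha>\<close> and for \<open>0\<close>, whose curves are
  segments, shows that the fractal is close to a segment for small \<open>\<alpha>\<close>.
\<close>

subsection \<open>Hausdorff closeness\<close>

text \<open>A two-sided closeness relation used in place of \<open>hausdist\<close>. Having no
  suprema or infima, it passes through unions, images and compositions without boundedness or
  nonemptiness conditions.\<close>

definition hclose :: "real \<Rightarrow> 'a::metric_space set \<Rightarrow> 'a set \<Rightarrow> bool" where
  "hclose e A B \<longleftrightarrow> (\<forall>x\<in>A. \<exists>y\<in>B. dist x y \<le> e) \<and> (\<forall>y\<in>B. \<exists>x\<in>A. dist x y \<le> e)"

lemma hclose_sym: "hclose e A B \<Longrightarrow> hclose e B A"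
  unfolding hclose_def by (simp add: dist_commute)

lemma hclose_mono: "hclose e A B \<Longrightarrow> e \<le> e' \<Longrightarrow> hclose e' A B"
  unfolding hclose_def by (meson order_trans)

lemma hclose_trans:
  assumes "hclose d A B" "hclose e B C" shows "hclose (d + e) A C"
proof -
  have "\<exists>y\<in>C. dist x y \<le> d + e" if "x \<in> A" for x
    using assms that unfolding hclose_def by (meson add_mono dist_triangle order_trans)
  moreover have "\<exists>x\<in>A. dist x y \<le> d + e" if "y \<in> C" for y
    using assms that unfolding hclose_def by (meson add_mono dist_triangle order_trans)
  ultimately show ?thesis unfolding hclose_def by blast
qed

lemma hclose_Un:
  "hclose e A B \<Longrightarrow> hclose e A' B' \<Longrightarrow> hclose e (A \<union> A') (B \<union> B')"
  unfolding hclose_def by blast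

text \<open>Two different maps are allowed, so that a perturbation of the set and one of the map are
  estimated together.\<close>

lemma hclose_image:
  assumes "hclose e A B"
    and "\<And>x y. x \<in> A \<Longrightarrow> y \<in> B \<Longrightarrow> dist x y \<le> e \<Longrightarrow> dist (f x) (g y) \<le> e'"
  shows "hclose e' (f ` A) (g ` B)"
proof -
  have "\<exists>y\<in>B. dist (f x) (g y) \<le> e'" if "x \<in> A" for x
    using assms that unfolding hclose_def by blast
  moreover have "\<exists>x\<in>A. dist (f x) (g y) \<le> e'" if "y \<in> B" for y
    using assms that unfolding hclose_def by blast
  ultimately show ?thesis unfolding hclose_def by blast
qed

lemma hclose_bounded:
  fixes A B :: "'a::real_normed_vector set"
  assumes "\<And>x. x \<in> A \<Longrightarrow> norm x \<le> r" "\<And>x. x \<in> B \<Longrightarrow> norm x \<le> s" "A \<noteq> {}" "B \<noteq> {}"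
  shows "hclose (r + s) A B"
proof -
  have "dist x y \<le> r + s" if "x \<in> A" "y \<in> B" for x y
    using norm_triangle_ineq4[of x y] assms(1)[OF that(1)] assms(2)[OF that(2)]
    by (simp add: dist_norm)
  then show ?thesis using assms(3,4) unfolding hclose_def by blast
qed

lemma hclose_imp_hausdist:
  assumes "hclose e U V" "U \<noteq> {}" "V \<noteq> {}"
  shows "0 \<le> hausdist U V" "hausdist U V \<le> e"
proof -
  have U: "infdist x V \<le> e" if "x \<in> U" for x
    using assms that unfolding hclose_def by (meson infdist_le2)
  have V: "infdist y U \<le> e" if "y \<in> V" for y
    using assms that unfolding hclose_def by (metis dist_commute infdist_le2)
  obtain x where x: "x \<in> U" using assms by blast
  have "0 \<le> infdist x V" by (rule infdist_nonneg)
  also have "\<dots> \<le> (SUP x\<in>U. infdist x V)"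
    using U x by (intro cSUP_upper) (auto intro!: bdd_aboveI)
  finally show "0 \<le> hausdist U V" by (simp add: hausdist_def)
  show "hausdist U V \<le> e"
    unfolding hausdist_def using U V assms by (auto intro!: cSUP_least)
qed

text \<open>The infimum in \<open>infdist\<close> need not be attained, but some point does better
  than any number strictly above it. Boundedness makes the real suprema in \<open>hausdist\<close>
  genuine upper bounds.\<close>

lemma hausdist_less_imp_hclose:
  assumes "hausdist U V < e" "bounded U" "bounded V" "U \<noteq> {}" "V \<noteq> {}"
  shows "hclose e U V"
proof -
  have bdd: "bdd_above ((\<lambda>x. infdist x B) ` A)"
    if A: "bounded A" and B: "B \<noteq> {}" for A B :: "(real \<times> real) set"
  proof -
    obtain b where b: "b \<in> B" using B by blast
    obtain r where r: "\<And>x. x \<in> A \<Longrightarrow> dist b x \<le> r"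
      using A bounded_any_center[of A b] by blast
    show ?thesis
      by (rule bdd_aboveI[of _ r]) (use b r in \<open>auto intro!: infdist_le2[OF b] simp: dist_commute\<close>)
  qed
  have near: "\<exists>y\<in>B. dist x y \<le> e" if "infdist x B < e" "B \<noteq> {}" for x and B :: "(real \<times> real) set"
    using that cINF_less_iff[of B "dist x" e] by (force simp: infdist_def)
  have "infdist x V < e" if "x \<in> U" for x
    using cSUP_upper[OF that bdd[OF assms(2,5)]] assms(1) by (simp add: hausdist_def)
  moreover have "infdist y U < e" if "y \<in> V" for y
    using cSUP_upper[OF that bdd[OF assms(3,4)]] assms(1) by (simp add: hausdist_def)
  ultimately show ?thesis
    using near[OF _ assms(4)] near[OF _ assms(5)] unfolding hclose_def by (metis dist_commute)
qed

lemma hclose_closed_eq: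
  assumes "closed A" "closed B" "\<And>e. e > 0 \<Longrightarrow> hclose e A B"
  shows "A = B"
proof -
  have "x \<in> B" if "x \<in> A" for x
  proof -
    have "\<exists>y\<in>B. dist y x < e" if "e > 0" for e
      using assms(3)[of "e/2"] \<open>x \<in> A\<close> that unfolding hclose_def
      by (metis dist_commute field_sum_of_halves half_gt_zero le_less_trans less_add_same_cancel1)
    then show ?thesis using assms(2) closed_approachable by blast
  qed
  moreover have "x \<in> A" if "x \<in> B" for x
  proof -
    have "\<exists>y\<in>A. dist y x < e" if "e > 0" for e
      using assms(3)[of "e/2"] \<open>x \<in> B\<close> that unfolding hclose_def
      by (metis field_sum_of_halves half_gt_zero le_less_trans less_add_same_cancel1)
    then show ?thesis using assms(1) closed_approachable by blast
  qed
  ultimately show ?thesis by blast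
qed

text \<open>Both limits are within \<open>e/2\<close> of a common \<open>S k\<close>, hence within
  \<open>e\<close> of each other for every \<open>e\<close>, and closed sets that are arbitrarily
  close agree. This evaluates the definite description in \<open>fib_fractal\<close>.\<close>

lemma hausdist_limit_unique:
  assumes "\<And>k. bounded (S k)" "\<And>k. S k \<noteq> {}"
    and "compact K" "K \<noteq> {}" "(\<lambda>k. hausdist (S k) K) \<longlonglongrightarrow> 0"
    and "compact L" "L \<noteq> {}" "(\<lambda>k. hausdist (S k) L) \<longlonglongrightarrow> 0"
  shows "K = L"
proof (rule hclose_closed_eq)
  show "closed K" "closed L" using assms compact_imp_closed by auto
  fix e :: real assume "e > 0"
  then have "\<forall>\<^sub>F k in sequentially. hausdist (S k) K < e/2 \<and> hausdist (S k) L < e/2"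
    using assms(5,8) by (intro eventually_conj order_tendstoD(2)) auto
  then obtain k where "hausdist (S k) K < e/2" "hausdist (S k) L < e/2"
    unfolding eventually_sequentially by blast
  then have "hclose (e/2) (S k) K" "hclose (e/2) (S k) L"
    using hausdist_less_imp_hclose[OF _ assms(1)[of k] _ assms(2)[of k]] assms(3,4,6,7)
      compact_imp_bounded by blast+
  from hclose_trans[OF hclose_sym[OF this(1)] this(2)] show "hclose e K L" by simp
qed

section \<open>Limits under geometrically decreasing steps, for points and for sets\<close>

lemma geometric_chain_limit:
  fixes y :: "nat \<Rightarrow> 'a::complete_space"
  assumes step: "\<And>j. dist (y j) (y (Suc j)) \<le> M * r ^ j" and r: "0 \<le> r" "r < 1"
  obtains l where "y \<longlonglongrightarrow> l" "\<And>j. dist (y j) l \<le> M * r ^ j / (1 - r)"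
proof -
  have M: "M \<ge> 0" using order_trans[OF zero_le_dist step[of 0]] by simp
  have part: "dist (y j) (y (j + n)) \<le> M * r ^ j * (1 - r ^ n) / (1 - r)" for j n
  proof (induction n)
    case (Suc n)
    have "dist (y j) (y (j + Suc n)) \<le> dist (y j) (y (j + n)) + dist (y (j + n)) (y (j + Suc n))"
      by (rule dist_triangle)
    also have "\<dots> \<le> M * r ^ j * (1 - r ^ n) / (1 - r) + M * r ^ (j + n)"
      using Suc step[of "j + n"] by simp
    also have "\<dots> = M * r ^ j * (1 - r ^ Suc n) / (1 - r)"
      using r by (simp add: field_simps power_add)
    finally show ?case .
  qed simp
  have tail: "dist (y j) (y (j + n)) \<le> M * r ^ j / (1 - r)" for j n
  proof -
    have "M * r ^ j * (1 - r ^ n) \<le> M * r ^ j * 1"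
      using M r by (intro mult_left_mono) auto
    then show ?thesis using part[of j n] r by (smt (verit) divide_right_mono mult.right_neutral)
  qed
  have "(\<lambda>j. M * r ^ j / (1 - r)) \<longlonglongrightarrow> 0"
    using r by (auto intro!: tendsto_eq_intros LIMSEQ_power_zero)
  then have "Cauchy y"
  proof (intro CauchyI')
    fix e :: real assume e: "e > 0" and lim: "(\<lambda>j. M * r ^ j / (1 - r)) \<longlonglongrightarrow> 0"
    then obtain N where "\<forall>j\<ge>N. M * r ^ j / (1 - r) < e"
      using order_tendstoD(2)[OF lim e] by (auto simp: eventually_sequentially)
    then show "\<exists>N. \<forall>m\<ge>N. \<forall>n>m. dist (y m) (y n) < e"
      using tail by (metis le_add_diff_inverse le_less_trans less_imp_le)
  qed
  then obtain l where l: "y \<longlonglongrightarrow> l" using Cauchy_convergent convergent_def by blast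
  have "dist (y j) l \<le> M * r ^ j / (1 - r)" for j
  proof (rule LIMSEQ_le_const2)
    show "(\<lambda>n. dist (y j) (y (n + j))) \<longlonglongrightarrow> dist (y j) l"
      using LIMSEQ_ignore_initial_segment[OF l, of j] by (intro tendsto_intros)
    show "\<exists>N. \<forall>n\<ge>N. dist (y j) (y (n + j)) \<le> M * r ^ j / (1 - r)"
      using tail[of j] by (simp add: add.commute)
  qed
  with l that show thesis by blast
qed

text \<open>A direct completeness argument: the limit is the closure of all limits of point
  sequences that pass from stage to stage with geometrically decreasing steps. The factor 2 pays for
  passing to the closure.\<close>

lemma hclose_geometric_limit:
  fixes S :: "nat \<Rightarrow> 'a::heine_borel set"
  assumes step: "\<And>k. hclose (M * r ^ k) (S k) (S (Suc k))"
    and ne: "\<And>k. S k \<noteq> {}" and bd: "bounded (S 0)" and M: "M > 0" and r: "0 < r" "r < 1"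
  obtains K where "compact K" "K \<noteq> {}" "\<And>k. hclose (2 * M / (1 - r) * r ^ k) (S k) K"
proof -
  \<comment> \<open>Chains may start at any stage \<open>m\<close>, so that every point of every
    \<open>S m\<close> begins one.\<close>
  define chain where "chain m y \<longleftrightarrow>
      (\<forall>j. y j \<in> S (m + j) \<and> dist (y j) (y (Suc j)) \<le> M * r ^ m * r ^ j)" for m y
  define L where "L = {l. \<exists>m y. chain m y \<and> y \<longlonglongrightarrow> l}"
  have climit: "\<exists>l\<in>L. dist (y 0) l \<le> M * r ^ m / (1 - r)" if "chain m y" for m y
  proof -
    obtain l where "y \<longlonglongrightarrow> l" "\<And>j. dist (y j) l \<le> M * r ^ m * r ^ j / (1 - r)"
      using geometric_chain_limit[of y "M * r ^ m" r] \<open>chain m y\<close> r by (auto simp: chain_def)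
    from this(1) this(2)[of 0] \<open>chain m y\<close> show ?thesis by (auto simp: L_def)
  qed
  have cex: "\<exists>y. chain m y \<and> y 0 = x" if "x \<in> S m" for m x
  proof -
    \<comment> \<open>The clause for \<open>n = 0\<close> makes the sequence obtained by dependent
      choice start at the prescribed point.\<close>
    have "\<exists>y. \<forall>n. (y n \<in> S (m + n) \<and> (n = 0 \<longrightarrow> y n = x)) \<and>
              dist (y n) (y (Suc n)) \<le> M * r ^ m * r ^ n"
    proof (rule dependent_nat_choice)
      show "\<exists>z. z \<in> S (m + 0) \<and> (0 = (0::nat) \<longrightarrow> z = x)" using that by auto
      fix z n assume "z \<in> S (m + n) \<and> (n = 0 \<longrightarrow> z = x)"
      then show "\<exists>w. (w \<in> S (m + Suc n) \<and> (Suc n = 0 \<longrightarrow> w = x)) \<and>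
          dist z w \<le> M * r ^ m * r ^ n"
        using step[of "m + n"] unfolding hclose_def by (simp add: power_add mult.assoc) blast
    qed
    then show ?thesis unfolding chain_def by blast
  qed
  have fwd: "\<exists>l\<in>L. dist x l \<le> M * r ^ k / (1 - r)" if "x \<in> S k" for x k
    using cex[OF that] climit by blast
  have many: "hclose (M * r ^ k * (1 - r ^ n) / (1 - r)) (S k) (S (k + n))" for k n
  proof (induction n)
    case 0
    show ?case by (auto simp: hclose_def)
  next
    case (Suc n)
    have "M * r ^ k * (1 - r ^ Suc n) / (1 - r) =
        M * r ^ k * (1 - r ^ n) / (1 - r) + M * r ^ (k + n)"
      using r by (simp add: field_simps power_add)
    then show ?case using hclose_trans[OF Suc step[of "k + n"]] by simp
  qed
  have bwd: "\<exists>x\<in>S k. dist x l \<le> M * r ^ k / (1 - r)" if "l \<in> L" for l k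
  proof -
    obtain m y where y: "chain m y" "y \<longlonglongrightarrow> l" using \<open>l \<in> L\<close> by (auto simp: L_def)
    obtain l' where l': "y \<longlonglongrightarrow> l'" "\<And>j. dist (y j) l' \<le> M * r ^ m * r ^ j / (1 - r)"
      using geometric_chain_limit[of y "M * r ^ m" r] y r by (auto simp: chain_def)
    then have tail: "dist (y j) l \<le> M * r ^ (m + j) / (1 - r)" for j
      using LIMSEQ_unique[OF y(2) l'(1)] by (simp add: power_add mult.assoc)
    show ?thesis
    proof (cases "k \<ge> m")
      case True
      then show ?thesis using tail[of "k - m"] y(1) unfolding chain_def
        by (metis le_add_diff_inverse)
    next
      case False
      \<comment> \<open>The chain starts after stage \<open>k\<close>. Its first point is traced
        back from stage \<open>m\<close> to stage \<open>k\<close>, and the two geometric sums add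
        up exactly to the required bound.\<close>
      then obtain n where n: "m = k + n" by (metis le_add_diff_inverse nat_le_linear)
      have "y 0 \<in> S (k + n)" using y(1) n unfolding chain_def by (metis add_0_right)
      then obtain x where x: "x \<in> S k" "dist x (y 0) \<le> M * r ^ k * (1 - r ^ n) / (1 - r)"
        using many[of k n] unfolding hclose_def by blast
      have "dist x l \<le> dist x (y 0) + dist (y 0) l" by (rule dist_triangle)
      also have "\<dots> \<le> M * r ^ k * (1 - r ^ n) / (1 - r) + M * r ^ (k + n) / (1 - r)"
        using x tail[of 0] n by simp
      also have "\<dots> = M * r ^ k / (1 - r)"
        unfolding add_divide_distrib[symmetric] by (simp add: algebra_simps power_add)
      finally show ?thesis using x by blast
    qed
  qed
  have hL: "hclose (M * r ^ k / (1 - r)) (S k) L" for k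
    using fwd bwd unfolding hclose_def by blast
  have pos: "M * r ^ k / (1 - r) > 0" for k using M r by simp
  have hK: "hclose (2 * M / (1 - r) * r ^ k) (S k) (closure L)" for k
  proof -
    let ?e = "M * r ^ k / (1 - r)"
    have "hclose ?e L (closure L)"
      unfolding hclose_def
    proof (intro conjI ballI)
      fix x assume "x \<in> L"
      then show "\<exists>y\<in>closure L. dist x y \<le> ?e"
        using pos[of k] closure_subset[of L] by (intro bexI[of _ x]) auto
    next
      fix y assume "y \<in> closure L"
      then show "\<exists>x\<in>L. dist x y \<le> ?e"
        using pos[of k] unfolding closure_approachable by (meson less_imp_le)
    qed
    from hclose_trans[OF hL[of k] this] show ?thesis by (simp add: field_simps)
  qed
  have "bounded L"
  proof -
    obtain x0 R where R: "\<And>x. x \<in> S 0 \<Longrightarrow> dist x0 x \<le> R" using bd by (auto simp: bounded_def)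
    have "dist x0 l \<le> R + M / (1 - r)" if l: "l \<in> L" for l
    proof -
      obtain x where "x \<in> S 0" "dist x l \<le> M / (1 - r)" using bwd[OF l, of 0] by auto
      then show ?thesis using R dist_triangle[of x0 l x] by fastforce
    qed
    then show ?thesis unfolding bounded_def by blast
  qed
  then have "compact (closure L)" by (simp add: compact_closure)
  moreover have "L \<noteq> {}" using fwd ne[of 0] by blast
  ultimately show thesis using that[of "closure L"] hK by (metis closure_eq_empty)
qed

subsection \<open>Turtle curves in the complex plane\<close>

text \<open>The turn in units of the angle. With headings independent of \<open>\<alpha>\<close>,
  negating \<open>\<alpha>\<close> amounts to complex conjugation.\<close>

definition uturn :: "nat list \<Rightarrow> nat \<Rightarrow> real" where
  "uturn w k = (if w ! k = 0 then (if odd k then 1 else -1) else 0)"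

definition heading :: "nat list \<Rightarrow> nat \<Rightarrow> real" where
  "heading w k = (\<Sum>l<k. uturn w l)"

definition pos :: "real \<Rightarrow> nat list \<Rightarrow> nat \<Rightarrow> complex" where
  "pos \<alpha> w k = (\<Sum>l<k. cis (\<alpha> * heading w l))"

definition polyline :: "real \<Rightarrow> nat list \<Rightarrow> complex set" where
  "polyline \<alpha> w = (\<Union>k<length w. closed_segment (pos \<alpha> w k) (pos \<alpha> w (Suc k)))"

abbreviation turning :: "nat list \<Rightarrow> real" where
  "turning w \<equiv> heading w (length w)"

abbreviation endpt :: "real \<Rightarrow> nat list \<Rightarrow> complex" where
  "endpt \<alpha> w \<equiv> pos \<alpha> w (length w)"

definition flip :: "nat \<Rightarrow> complex \<Rightarrow> complex" where
  "flip n z = (if even n then z else cnj z)"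

text \<open>The complex curves start in direction \<open>1\<close>; the quarter turn restores the direction \<open>\<pi>/2\<close>.\<close>

definition to_plane :: "complex \<Rightarrow> real \<times> real" where
  "to_plane z = (- Im z, Re z)"

lemma linear_flip: "linear (flip n)"
  by (rule linearI) (auto simp: flip_def)

lemma linear_to_plane: "linear to_plane"
  by (rule linearI) (auto simp: to_plane_def)

lemma norm_to_plane [simp]: "norm (to_plane z) = norm z"
  by (simp add: to_plane_def norm_Pair cmod_def add.commute)

lemma dist_to_plane [simp]: "dist (to_plane x) (to_plane y) = dist x y"
  by (metis dist_norm linear_diff linear_to_plane norm_to_plane)

lemma uturn_append:
  "l < length u \<Longrightarrow> uturn (u @ w) l = uturn u l"
  "uturn (u @ w) (length u + l) = (-1) ^ length u * uturn w l"
  by (auto simp: uturn_def nth_append)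

lemma heading_append:
  "k \<le> length u \<Longrightarrow> heading (u @ w) k = heading u k"
  "heading (u @ w) (length u + k) = turning u + (-1) ^ length u * heading w k"
proof -
  show *: "heading (u @ w) k = heading u k" if "k \<le> length u" for k
    unfolding heading_def using that by (intro sum.cong) (auto simp: uturn_append)
  show "heading (u @ w) (length u + k) = turning u + (-1) ^ length u * heading w k"
  proof (induction k)
    case 0
    show ?case using *[of "length u"] by (simp add: heading_def)
  next
    case (Suc k)
    then show ?case by (simp add: heading_def uturn_append distrib_left)
  qed
qed

text \<open>A prefix of odd length exchanges even and odd positions, so every turn of
  \<open>w\<close> changes sign and its curve is reflected; \<open>flip\<close> records
  this.\<close>

lemma pos_append:
  "k \<le> length u \<Longrightarrow> pos \<alpha> (u @ w) k = pos \<alpha> u k"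
  "pos \<alpha> (u @ w) (length u + k) =
     endpt \<alpha> u + cis (\<alpha> * turning u) * flip (length u) (pos \<alpha> w k)"
proof -
  show *: "pos \<alpha> (u @ w) k = pos \<alpha> u k" if "k \<le> length u" for k
    unfolding pos_def using that by (intro sum.cong) (auto simp: heading_append)
  show "pos \<alpha> (u @ w) (length u + k) =
     endpt \<alpha> u + cis (\<alpha> * turning u) * flip (length u) (pos \<alpha> w k)"
  proof (induction k)
    case 0
    show ?case using *[of "length u"] by (simp add: pos_def flip_def)
  next
    case (Suc k)
    have "cis (\<alpha> * heading (u @ w) (length u + k)) =
        cis (\<alpha> * turning u) * flip (length u) (cis (\<alpha> * heading w k))"
      by (simp add: heading_append flip_def cis_mult cis_cnj distrib_left right_diff_distrib)
    with Suc show ?case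
      by (simp add: pos_def linear_add[OF linear_flip] algebra_simps)
  qed
qed

lemma turning_append: "turning (u @ w) = turning u + (-1) ^ length u * turning w"
  using heading_append(2)[of u w "length w"] by simp

lemma endpt_append:
  "endpt \<alpha> (u @ w) = endpt \<alpha> u + cis (\<alpha> * turning u) * flip (length u) (endpt \<alpha> w)"
  using pos_append(2)[of \<alpha> u w "length w"] by simp

lemma polyline_append:
  "polyline \<alpha> (u @ w) =
     polyline \<alpha> u \<union> (\<lambda>z. endpt \<alpha> u + cis (\<alpha> * turning u) * flip (length u) z) ` polyline \<alpha> w"
    (is "_ = _ \<union> ?f ` _")
proof -
  let ?s = "\<lambda>v k. closed_segment (pos \<alpha> v k) (pos \<alpha> v (Suc k))"
  have lin: "linear (\<lambda>z. cis (\<alpha> * turning u) * flip (length u) z)"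
    using linear_compose[OF linear_flip linear_times] by (simp add: o_def)
  have seg: "?f ` closed_segment x y = closed_segment (?f x) (?f y)" for x y
    using closed_segment_translation[of "endpt \<alpha> u"] closed_segment_linear_image[OF lin]
    by (metis (no_types, lifting) image_image image_cong)
  have "{..<length (u @ w)} = {..<length u} \<union> (+) (length u) ` {..<length w}"
    by (auto simp: image_iff) (metis add_diff_inverse_nat nat_add_left_cancel_less lessThan_iff)
  then have "polyline \<alpha> (u @ w) = (\<Union>k<length u. ?s (u @ w) k) \<union>
      (\<Union>k<length w. ?s (u @ w) (length u + k))"
    unfolding polyline_def by auto
  also have "(\<Union>k<length u. ?s (u @ w) k) = polyline \<alpha> u"
    unfolding polyline_def by (intro SUP_cong) (auto simp: pos_append)
  also have "(\<Union>k<length w. ?s (u @ w) (length u + k)) = (\<Union>k<length w. ?f ` ?s w k)"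
    unfolding seg add_Suc_right[symmetric] pos_append ..
  also have "\<dots> = ?f ` polyline \<alpha> w" unfolding polyline_def by blast
  finally show ?thesis .
qed

lemma heading_0 [simp]: "heading w 0 = 0" and pos_0 [simp]: "pos \<alpha> w 0 = 0"
  by (simp_all add: heading_def pos_def)

lemma cnj_pos: "cnj (pos \<alpha> w k) = pos (- \<alpha>) w k"
  by (simp add: pos_def cis_cnj)

lemma cnj_polyline: "cnj ` polyline \<alpha> w = polyline (- \<alpha>) w"
  unfolding polyline_def image_UN
  by (simp add: closed_segment_linear_image[OF linear_cnj, symmetric] cnj_pos[symmetric])

lemma polyline_bounded: "bounded (polyline \<alpha> w)"
  unfolding polyline_def by (intro bounded_UN) (auto intro: bounded_closed_segment)

lemma polyline_nonempty: "w \<noteq> [] \<Longrightarrow> polyline \<alpha> w \<noteq> {}"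
  unfolding polyline_def by auto

lemma pos_zero_angle: "pos 0 w k = of_nat k"
  by (simp add: pos_def)

lemma polyline_zero_angle:
  assumes "w \<noteq> []"
  shows "polyline 0 w = closed_segment 0 (of_nat (length w))"
proof -
  have "(\<Union>k<n. closed_segment (of_nat k) (of_nat (Suc k))) = closed_segment (0::complex) (of_nat n)"
    if "n > 0" for n
    using that
  proof (induction n rule: nat_induct_non_zero)
    case 1
    show ?case by (simp add: lessThan_Suc)
  next
    case (Suc n)
    have "of_nat n \<in> closed_segment (0::complex) (of_nat (Suc n))"
      unfolding in_segment
      by (intro exI[of _ "real n / real (Suc n)"]) (simp add: scaleR_conv_of_real field_simps
          del: of_nat_Suc)
    then have "closed_segment (0::complex) (of_nat n) \<union> closed_segment (of_nat n) (of_nat (Suc n)) =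
        closed_segment 0 (of_nat (Suc n))"
      by (rule Un_closed_segment)
    with Suc show ?case by (simp add: lessThan_Suc Un_commute del: of_nat_Suc)
  qed
  with assms show ?thesis by (simp add: polyline_def pos_zero_angle)
qed

lemma vertex_eq_to_plane: "vertex w \<alpha> k = to_plane (pos \<alpha> w k)"
proof -
  have "turn w \<alpha> l = \<alpha> * uturn w l" for l by (simp add: turn_def uturn_def)
  then have "dir w \<alpha> l = pi / 2 + \<alpha> * heading w l" for l
    by (simp add: dir_def heading_def sum_distrib_left)
  then show ?thesis
    unfolding vertex_def pos_def linear_sum[OF linear_to_plane]
    by (intro sum.cong) (auto simp: to_plane_def cos_add sin_add)
qed

lemma curve_eq_to_plane: "curve w \<alpha> = to_plane ` polyline \<alpha> w"
  unfolding curve_def polyline_def vertex_eq_to_plane image_UN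
  by (simp add: closed_segment_linear_image[OF linear_to_plane, symmetric])

lemma endlen_eq: "endlen w \<alpha> = norm (endpt \<alpha> w)"
  unfolding endlen_def vertex_eq_to_plane zero_prod_def[symmetric] by simp

lemma scaled_curve_eq:
  "scaled_curve i \<alpha> n =
     (\<lambda>z. to_plane ((sqrt 2 / norm (endpt \<alpha> (fibw i n))) *\<^sub>R z)) ` polyline \<alpha> (fibw i n)"
  unfolding scaled_curve_def curve_eq_to_plane endlen_eq image_image
  by (simp add: linear_scale[OF linear_to_plane])

subsection \<open>The folding recursion\<close>

text \<open>\<open>X (Suc k)\<close> is expressed through \<open>Y (Suc k)\<close>, so that each
  fact about \<open>X\<close> at the next generation reuses the one just proved for
  \<open>Y\<close>.\<close>

locale folded_words =
  fixes X Y :: "nat \<Rightarrow> nat list" and s :: real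
  assumes X_Suc: "X (Suc k) = Y (Suc k) @ X k @ Y k"
    and Y_Suc: "Y (Suc k) = X k @ Y k @ X k"
    and X0: "X 0 \<noteq> []" "even (length (X 0))" "turning (X 0) = 1"
    and Y0: "odd (length (Y 0))" "turning (Y 0) = s"
begin

lemma parity: "even (length (X k))" "odd (length (Y k))"
  by (induction k) (auto simp: X_Suc Y_Suc X0 Y0)

text \<open>In \<open>Y (Suc k)\<close> the second \<open>X k\<close> follows a prefix of odd
  length, so its turning cancels that of the first. In \<open>X (Suc k)\<close> the odd prefix
  contributes \<open>s\<close> and reverses the turnings of \<open>X k\<close> and
  \<open>Y k\<close>, which leaves the negative of the turning of \<open>X k\<close>.\<close>

lemma turning: "turning (X k) = (-1) ^ k" "turning (Y k) = s"
proof (induction k)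
  case 0
  show "turning (X 0) = (-1) ^ 0" "turning (Y 0) = s" by (simp_all add: X0 Y0)
next
  case (Suc k)
  show Y: "turning (Y (Suc k)) = s"
    unfolding Y_Suc turning_append using Suc parity by simp
  show "turning (X (Suc k)) = (-1) ^ Suc k"
    unfolding X_Suc turning_append Y using Suc parity by simp
qed

lemma X_nonempty: "X k \<noteq> []"
  by (induction k) (auto simp: X0 X_Suc Y_Suc)

lemma Y_nonempty: "Y k \<noteq> []"
  using parity(2)[of k] by auto

text \<open>Replacing \<open>\<alpha>\<close> by \<open>-\<alpha>\<close> reflects a curve, which undoes the alternating sign of the turning of \<open>X k\<close>;
  rotating back by half the turning of \<open>Y k\<close> then removes \<open>s\<close> from the recursion.\<close>

definition rot :: "real \<Rightarrow> nat \<Rightarrow> complex" where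
  "rot \<alpha> k = cis (- (s * ((-1) ^ k * \<alpha>) / 2))"

definition xend :: "real \<Rightarrow> nat \<Rightarrow> complex" where
  "xend \<alpha> k = rot \<alpha> k * endpt ((-1) ^ k * \<alpha>) (X k)"

definition yend :: "real \<Rightarrow> nat \<Rightarrow> complex" where
  "yend \<alpha> k = rot \<alpha> k * endpt ((-1) ^ k * \<alpha>) (Y k)"

definition xset :: "real \<Rightarrow> nat \<Rightarrow> complex set" where
  "xset \<alpha> k = (*) (rot \<alpha> k) ` polyline ((-1) ^ k * \<alpha>) (X k)"

definition yset :: "real \<Rightarrow> nat \<Rightarrow> complex set" where
  "yset \<alpha> k = (*) (rot \<alpha> k) ` polyline ((-1) ^ k * \<alpha>) (Y k)"

lemma rot_Suc: "rot \<alpha> (Suc k) = cnj (rot \<alpha> k)"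
  by (simp add: rot_def cis_cnj)

text \<open>This identity is the reason for the half angle in \<open>rot\<close>: the factor coming
  from \<open>Y k\<close> is absorbed into a conjugation.\<close>

lemma rot_turn: "rot \<alpha> k * cis ((-1) ^ k * \<alpha> * s) = cnj (rot \<alpha> k)"
  by (simp add: rot_def cis_cnj cis_mult algebra_simps)

text \<open>With drawing angle \<open>(-1) ^ k * \<alpha>\<close>, the total turning of
  \<open>X k\<close> is thus always the angle \<open>\<alpha>\<close> itself.\<close>

lemma alternate_sign: "(-1) ^ k * \<alpha> * (-1) ^ k = (\<alpha>::real)"
  by (cases "even k") auto

lemma polyline_flip: "polyline ((-1) ^ Suc k * \<alpha>) w = cnj ` polyline ((-1) ^ k * \<alpha>) w"
  by (simp add: cnj_polyline)

lemma endpt_next: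
  fixes k \<alpha> defines "\<beta> \<equiv> (-1) ^ k * \<alpha>"
  shows "endpt \<beta> (Y (Suc k)) =
      endpt \<beta> (X k) + cis \<alpha> * (endpt \<beta> (Y k) + cis (\<beta> * s) * cnj (endpt \<beta> (X k)))"
    and "endpt \<beta> (X (Suc k)) = endpt \<beta> (Y (Suc k)) +
      cis (\<beta> * s) * cnj (endpt \<beta> (X k) + cis \<alpha> * endpt \<beta> (Y k))"
proof -
  show "endpt \<beta> (Y (Suc k)) =
      endpt \<beta> (X k) + cis \<alpha> * (endpt \<beta> (Y k) + cis (\<beta> * s) * cnj (endpt \<beta> (X k)))"
    unfolding Y_Suc endpt_append turning
    by (simp add: parity flip_def \<beta>_def alternate_sign)
  show "endpt \<beta> (X (Suc k)) = endpt \<beta> (Y (Suc k)) +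
      cis (\<beta> * s) * cnj (endpt \<beta> (X k) + cis \<alpha> * endpt \<beta> (Y k))"
    unfolding X_Suc endpt_append turning
    by (simp add: parity flip_def \<beta>_def alternate_sign)
qed

text \<open>Passing to the next generation negates the angle, which conjugates the recursion in
  \<open>endpt_next\<close>. After \<open>rot_turn\<close> the coefficients depend on neither
  \<open>k\<close> nor \<open>s\<close>.\<close>

lemma yend_Suc: "yend \<alpha> (Suc k) = cnj (xend \<alpha> k + cis \<alpha> * yend \<alpha> k + cis \<alpha> * cnj (xend \<alpha> k))"
proof -
  let ?\<beta> = "(-1) ^ k * \<alpha>"
  have "rot \<alpha> k * endpt ?\<beta> (Y (Suc k)) = xend \<alpha> k + cis \<alpha> * (yend \<alpha> k +
      (rot \<alpha> k * cis (?\<beta> * s)) * cnj (endpt ?\<beta> (X k)))"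
    unfolding endpt_next xend_def yend_def by (simp add: algebra_simps)
  also have "\<dots> = xend \<alpha> k + cis \<alpha> * yend \<alpha> k + cis \<alpha> * cnj (xend \<alpha> k)"
    unfolding rot_turn xend_def by (simp add: algebra_simps)
  finally have "cnj (rot \<alpha> k * endpt ?\<beta> (Y (Suc k))) = cnj \<dots>" by simp
  then show ?thesis by (simp add: yend_def rot_Suc cnj_pos)
qed

text \<open>The part after \<open>Y (Suc k)\<close> is reflected once by the odd prefix and once by
  the change of sign of the angle, so these two conjugations cancel.\<close>

lemma xend_Suc: "xend \<alpha> (Suc k) = yend \<alpha> (Suc k) + xend \<alpha> k + cis \<alpha> * yend \<alpha> k"
proof -
  let ?\<beta> = "(-1) ^ k * \<alpha>"
  have "rot \<alpha> k * endpt ?\<beta> (X (Suc k)) = rot \<alpha> k * endpt ?\<beta> (Y (Suc k)) +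
      (rot \<alpha> k * cis (?\<beta> * s)) * cnj (endpt ?\<beta> (X k) + cis \<alpha> * endpt ?\<beta> (Y k))"
    unfolding endpt_next by (simp add: algebra_simps)
  also have "\<dots> = rot \<alpha> k * endpt ?\<beta> (Y (Suc k)) + cnj (xend \<alpha> k + cis \<alpha> * yend \<alpha> k)"
    unfolding rot_turn xend_def yend_def by (simp add: algebra_simps)
  finally have "cnj (rot \<alpha> k * endpt ?\<beta> (X (Suc k))) = cnj \<dots>" by simp
  then show ?thesis by (simp add: xend_def yend_def rot_Suc cnj_pos)
qed

lemma polyline_next:
  fixes k \<alpha> defines "\<beta> \<equiv> (-1) ^ k * \<alpha>"
  shows "polyline \<beta> (Y (Suc k)) = polyline \<beta> (X k) \<union>
      (\<lambda>z. endpt \<beta> (X k) + cis \<alpha> * z) ` (polyline \<beta> (Y k) \<union>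
        (\<lambda>z. endpt \<beta> (Y k) + cis (\<beta> * s) * cnj z) ` polyline \<beta> (X k))"
    and "polyline \<beta> (X (Suc k)) = polyline \<beta> (Y (Suc k)) \<union>
      (\<lambda>z. endpt \<beta> (Y (Suc k)) + cis (\<beta> * s) * cnj z) ` (polyline \<beta> (X k) \<union>
        (\<lambda>z. endpt \<beta> (X k) + cis \<alpha> * z) ` polyline \<beta> (Y k))"
proof -
  show "polyline \<beta> (Y (Suc k)) = polyline \<beta> (X k) \<union>
      (\<lambda>z. endpt \<beta> (X k) + cis \<alpha> * z) ` (polyline \<beta> (Y k) \<union>
        (\<lambda>z. endpt \<beta> (Y k) + cis (\<beta> * s) * cnj z) ` polyline \<beta> (X k))"
    unfolding Y_Suc polyline_append turning
    by (simp add: parity flip_def \<beta>_def alternate_sign)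
  show "polyline \<beta> (X (Suc k)) = polyline \<beta> (Y (Suc k)) \<union>
      (\<lambda>z. endpt \<beta> (Y (Suc k)) + cis (\<beta> * s) * cnj z) ` (polyline \<beta> (X k) \<union>
        (\<lambda>z. endpt \<beta> (X k) + cis \<alpha> * z) ` polyline \<beta> (Y k))"
    unfolding X_Suc polyline_append turning
    by (simp add: parity flip_def \<beta>_def alternate_sign)
qed

text \<open>The rotated curve of \<open>X k @ Y k\<close>, which opens \<open>Y (Suc k)\<close> and
  closes \<open>X (Suc k)\<close>.\<close>

definition gset :: "real \<Rightarrow> nat \<Rightarrow> complex set" where
  "gset \<alpha> k = xset \<alpha> k \<union> (\<lambda>z. xend \<alpha> k + cis \<alpha> * z) ` yset \<alpha> k"

lemma yset_Suc: "yset \<alpha> (Suc k) =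
    cnj ` (gset \<alpha> k \<union> (\<lambda>z. xend \<alpha> k + cis \<alpha> * yend \<alpha> k + cis \<alpha> * cnj z) ` xset \<alpha> k)"
proof -
  let ?\<beta> = "(-1) ^ k * \<alpha>" and ?r = "rot \<alpha> k"
  have 1: "?r * (endpt ?\<beta> (Y k) + cis (?\<beta> * s) * cnj z) = yend \<alpha> k + cnj (?r * z)" for z
    using rot_turn[of \<alpha> k] by (simp add: yend_def distrib_left flip: mult.assoc)
  have 2: "?r * (endpt ?\<beta> (X k) + cis \<alpha> * z) = xend \<alpha> k + cis \<alpha> * (?r * z)" for z
    unfolding xend_def by (simp add: algebra_simps)
  have "(*) ?r ` polyline ?\<beta> (Y (Suc k)) =
      gset \<alpha> k \<union> (\<lambda>z. xend \<alpha> k + cis \<alpha> * yend \<alpha> k + cis \<alpha> * cnj z) ` xset \<alpha> k"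
    unfolding polyline_next gset_def xset_def yset_def image_Un image_image 2 1 Un_assoc
    by (simp add: distrib_left add.assoc)
  moreover have "yset \<alpha> (Suc k) = cnj ` ((*) ?r ` polyline ?\<beta> (Y (Suc k)))"
    unfolding yset_def rot_Suc polyline_flip image_image complex_cnj_mult ..
  ultimately show ?thesis by simp
qed

lemma xset_Suc: "xset \<alpha> (Suc k) = yset \<alpha> (Suc k) \<union> (\<lambda>z. yend \<alpha> (Suc k) + z) ` gset \<alpha> k"
proof -
  let ?\<beta> = "(-1) ^ k * \<alpha>" and ?r = "rot \<alpha> k"
  have 1: "cnj (?r * (endpt ?\<beta> (Y (Suc k)) + cis (?\<beta> * s) * cnj z)) = yend \<alpha> (Suc k) + ?r * z" for z
  proof -
    have "?r * (endpt ?\<beta> (Y (Suc k)) + cis (?\<beta> * s) * cnj z) =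
      ?r * endpt ?\<beta> (Y (Suc k)) + (?r * cis (?\<beta> * s)) * cnj z"
      by (simp add: algebra_simps)
    then show ?thesis unfolding rot_turn by (simp add: yend_def rot_Suc cnj_pos)
  qed
  have 2: "?r * (endpt ?\<beta> (X k) + cis \<alpha> * z) = xend \<alpha> k + cis \<alpha> * (?r * z)" for z
    unfolding xend_def by (simp add: algebra_simps)
  have "xset \<alpha> (Suc k) = cnj ` ((*) ?r ` polyline ?\<beta> (X (Suc k)))"
    unfolding xset_def rot_Suc polyline_flip image_image complex_cnj_mult ..
  also have "\<dots> = cnj ` ((*) ?r ` polyline ?\<beta> (Y (Suc k))) \<union> (\<lambda>z. yend \<alpha> (Suc k) + z) ` gset \<alpha> k"
    unfolding polyline_next(2) gset_def xset_def yset_def image_Un image_image 1 2 ..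
  also have "cnj ` ((*) ?r ` polyline ?\<beta> (Y (Suc k))) = yset \<alpha> (Suc k)"
    unfolding yset_def rot_Suc polyline_flip image_image complex_cnj_mult ..
  finally show ?thesis .
qed

text \<open>Together with their conjugates the two ends satisfy a linear system of size 4 with
  constant coefficients. The recurrence is the relation given by its characteristic polynomial, here
  checked by expanding four steps.\<close>

lemma end_recurrence:
  fixes \<alpha> defines "m \<equiv> of_real (2 + 2 * cos \<alpha>)"
  shows "xend \<alpha> (k + 4) = m * xend \<alpha> (k + 3) + 2 * xend \<alpha> (k + 2) - m * xend \<alpha> (k + 1) - xend \<alpha> k"
    and "yend \<alpha> (k + 4) = m * yend \<alpha> (k + 3) + 2 * yend \<alpha> (k + 2) - m * yend \<alpha> (k + 1) - yend \<alpha> k"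
proof -
  define a a' where "a = cis \<alpha>" and "a' = cnj a"
  have aa: "a * a' = 1" by (simp add: a_def a'_def cis_cnj cis_mult)
  have m: "m = 2 + a + a'" by (simp add: m_def a_def a'_def complex_eq_iff)
  \<comment> \<open>The conjugates are treated as separate unknowns, which turns the system into a
    complex linear one. The only relation then needed is \<open>a * a' = 1\<close>.\<close>
  define x y x' y' where "x n = xend \<alpha> (k + n)" and "y n = yend \<alpha> (k + n)"
    and "x' n = cnj (xend \<alpha> (k + n))" and "y' n = cnj (yend \<alpha> (k + n))" for n
  have r: "y (Suc n) = x' n + a' * y' n + a' * x n" "y' (Suc n) = x n + a * y n + a * x' n"
     "x (Suc n) = y (Suc n) + x n + a * y n" "x' (Suc n) = y' (Suc n) + x' n + a' * y' n" for n
    by (simp_all add: x_def y_def x'_def y'_def a_def a'_def xend_Suc yend_Suc)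
  have ac: "a * (a' * z) = z" "a' * (a * z) = z" for z
    using aa by (simp_all add: mult.assoc[symmetric] mult.commute[of a'])
  note expand = distrib_left distrib_right mult.assoc aa ac r
  have "x (Suc (Suc (Suc (Suc 0)))) = (2 + a + a') * x (Suc (Suc (Suc 0))) +
      2 * x (Suc (Suc 0)) - (2 + a + a') * x (Suc 0) - x 0"
    by (simp add: expand) (use aa in algebra)
  moreover have "y (Suc (Suc (Suc (Suc 0)))) = (2 + a + a') * y (Suc (Suc (Suc 0))) +
      2 * y (Suc (Suc 0)) - (2 + a + a') * y (Suc 0) - y 0"
    by (simp add: expand) (use aa in algebra)
  ultimately show
    "xend \<alpha> (k + 4) = m * xend \<alpha> (k + 3) + 2 * xend \<alpha> (k + 2) - m * xend \<alpha> (k + 1) - xend \<alpha> k"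
    "yend \<alpha> (k + 4) = m * yend \<alpha> (k + 3) + 2 * yend \<alpha> (k + 2) - m * yend \<alpha> (k + 1) - yend \<alpha> k"
    unfolding m by (simp_all add: x_def y_def numeral_eq_Suc)
qed

end

subsection \<open>Growth of the end points\<close>

text \<open>The larger root of \<open>x^2 = (2 + 2 * cos \<alpha>) * x + 1\<close>.\<close>

definition growth :: "real \<Rightarrow> real" where
  "growth \<alpha> = 1 + cos \<alpha> + sqrt ((1 + cos \<alpha>)\<^sup>2 + 1)"

lemma growth_eq: "(growth \<alpha>)\<^sup>2 = (2 + 2 * cos \<alpha>) * growth \<alpha> + 1"
proof -
  have "(sqrt ((1 + cos \<alpha>)\<^sup>2 + 1))\<^sup>2 = (1 + cos \<alpha>)\<^sup>2 + 1"
    by (intro real_sqrt_pow2) auto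
  then show ?thesis unfolding growth_def by algebra
qed

lemma growth_tendsto: "(growth \<longlongrightarrow> growth 0) (at_right 0)"
  unfolding growth_def by (intro tendsto_intros)

lemma growth_zero_gt: "growth 0 > 2"
  by (simp add: growth_def)

text \<open>The coefficient of \<open>\<mu> ^ k\<close> in \<open>z k\<close>. The polynomial
  \<open>(x + 1/\<mu>) * (x^2 - 1)\<close> annihilates the contributions of the other roots; it is
  applied to \<open>z\<close> as a shift operator and divided by its value at
  \<open>\<mu>\<close>.\<close>

definition lead :: "real \<Rightarrow> (nat \<Rightarrow> complex) \<Rightarrow> complex" where
  "lead \<mu> z = (z 3 + z 2 / of_real \<mu> - z 1 - z 0 / of_real \<mu>) / of_real (\<mu> ^ 3 - 1 / \<mu>)"

text \<open>All characteristic roots other than \<open>\<mu>\<close>, namely \<open>-1/\<mu>\<close> and \<open>\<plusminus>1\<close>, have modulus at most 1.\<close>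

lemma lead_approx:
  fixes z :: "nat \<Rightarrow> complex" and m \<mu> :: real
  assumes rec: "\<And>k. z (k + 4) = of_real m * z (k + 3) + 2 * z (k + 2) - of_real m * z (k + 1) - z k"
    and \<mu>: "\<mu> > 1" "\<mu>\<^sup>2 = m * \<mu> + 1"
  obtains B where "B > 0" "\<And>k. norm (z k - \<mu> ^ k *\<^sub>R lead \<mu> z) \<le> B"
proof -
  define L where "L = complex_of_real \<mu>"
  have L0: "L \<noteq> 0" using \<mu> by (simp add: L_def)
  have "m = \<mu> - 1 / \<mu>" using \<mu> by (simp add: field_simps power2_eq_square)
  then have m: "of_real m = L - 1 / L" by (simp add: L_def)
  define p where "p = lead \<mu> z"
  \<comment> \<open>This combination removes all roots but \<open>\<mu>\<close>, so \<open>e\<close>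
    is a pure geometric sequence.\<close>
  define e where "e k = z (k + 3) + z (k + 2) / L - z (k + 1) - z k / L" for k
  have "e (Suc k) = L * e k" for k
    using rec[of k] L0 by (simp add: e_def m field_simps numeral_eq_Suc)
  then have e: "e k = L ^ k * e 0" for k by (induction k) auto
  have "\<mu> ^ 3 - 1 / \<mu> \<noteq> 0"
  proof -
    have "1 / \<mu> < 1" "1 < \<mu> ^ 3" using \<mu> by auto
    then show ?thesis by linarith
  qed
  then have "of_real (\<mu> ^ 3 - 1 / \<mu>) * p = e 0"
    unfolding p_def lead_def e_def by (simp add: L_def numeral_2_eq_2 del: of_real_diff)
  then have p: "e 0 = (L ^ 3 - 1 / L) * p" by (simp add: L_def)
  define r where "r k = z k - L ^ k * p" for k
  \<comment> \<open>After the leading term is subtracted, removing the root \<open>-1/\<mu>\<close>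
    as well leaves only the roots 1 and -1, hence period 2.\<close>
  define g where "g k = r (k + 1) + r k / L" for k
  have "g (k + 2) = g k" for k
  proof -
    have "g (k + 2) - g k = e k - L ^ k * ((L ^ 3 - 1 / L) * p)"
      using L0 by (simp add: g_def r_def e_def field_simps numeral_eq_Suc)
    then show ?thesis using e[of k] p by simp
  qed
  then have g: "norm (g k) \<le> norm (g 0) + norm (g 1)" for k
    by (induction k rule: nat_induct2) (auto simp: numeral_eq_Suc)
  define A where "A = norm (g 0) + norm (g 1)"
  \<comment> \<open>\<open>A * \<mu> / (\<mu> - 1)\<close> is the fixed point of
    \<open>t \<mapsto> A + t / \<mu>\<close>, so a bound at least this large reproduces itself. The
    other summands cover the start and give positivity.\<close>
  define B where "B = norm (r 0) + A * \<mu> / (\<mu> - 1) + 1"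
  have A: "A \<ge> 0" by (simp add: A_def)
  have AB: "A + B / \<mu> \<le> B"
  proof -
    have "A * \<mu> / (\<mu> - 1) \<le> B" by (simp add: B_def)
    then show ?thesis using \<mu> by (simp add: field_simps)
  qed
  have "norm (r k) \<le> B" for k
  proof (induction k)
    case 0
    show ?case using \<mu> A by (simp add: B_def)
  next
    case (Suc k)
    have "norm (r (Suc k)) = norm (g k - r k / L)" by (simp add: g_def)
    also have "\<dots> \<le> norm (g k) + norm (r k / L)" by (rule norm_triangle_ineq4)
    also have "\<dots> \<le> A + B / \<mu>"
      using g[of k] Suc \<mu> by (auto simp: A_def norm_divide L_def divide_right_mono intro!: add_mono)
    finally show ?case using AB by simp
  qed
  moreover have "B > 0" using A \<mu> unfolding B_def
    by (intro add_nonneg_pos add_nonneg_nonneg) auto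
  ultimately show thesis
    using that[of B] by (simp add: r_def p_def L_def scaleR_conv_of_real)
qed

subsection \<open>Contraction\<close>

lemma norm_mult_diff_le:
  fixes a a' x y :: complex
  assumes "norm (x - y) \<le> d" "norm (a - a') \<le> \<epsilon>" "norm y \<le> R"
  shows "norm (a * x - a' * y) \<le> norm a * d + \<epsilon> * R"
proof -
  have "a * x - a' * y = a * (x - y) + (a - a') * y" by (simp add: algebra_simps)
  then have "norm (a * x - a' * y) \<le> norm (a * (x - y)) + norm ((a - a') * y)"
    by (metis norm_triangle_ineq)
  also have "\<dots> \<le> norm a * d + \<epsilon> * R"
    using assms order_trans[OF norm_ge_zero assms(2)]
    by (auto simp: norm_mult intro!: add_mono mult_mono mult_left_mono)
  finally show ?thesis .
qed

lemma norm_unit_mult_diff_le: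
  fixes a a' x y :: complex
  assumes "norm a = 1" "norm (x - y) \<le> d" "norm (a - a') \<le> \<epsilon>" "norm y \<le> R"
  shows "norm (a * x - a' * y) \<le> d + \<epsilon> * R"
  using norm_mult_diff_le[OF assms(2-4)] assms(1) by simp

lemma norm_scaleR_diff_le:
  fixes x y :: complex
  assumes "0 \<le> l" "norm (x - y) \<le> d" "\<bar>l - l'\<bar> \<le> \<epsilon>" "norm y \<le> R"
  shows "norm (l *\<^sub>R x - l' *\<^sub>R y) \<le> l * d + \<epsilon> * R"
  using norm_mult_diff_le[of x y d "of_real l" "of_real l'" \<epsilon> R] assms
  by (simp add: scaleR_conv_of_real flip: of_real_diff)

text \<open>Abstract form of one generation of the normalised system: \<open>a\<close> is the
  rotation, \<open>c\<close> and \<open>b\<close> the current ends of \<open>X\<close> and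
  \<open>Y\<close>, and \<open>l\<close> below the scaling factor.\<close>

definition gstep :: "complex \<Rightarrow> complex \<Rightarrow> complex set \<Rightarrow> complex set \<Rightarrow> complex set" where
  "gstep a c C D = C \<union> (\<lambda>z. c + a * z) ` D"

definition ystep ::
    "real \<Rightarrow> complex \<Rightarrow> complex \<Rightarrow> complex \<Rightarrow> complex set \<Rightarrow> complex set \<Rightarrow> complex set" where
  "ystep l a c b C D = (\<lambda>z. l *\<^sub>R cnj z) ` (gstep a c C D \<union> (\<lambda>z. c + a * b + a * cnj z) ` C)"

text \<open>\<open>b1\<close> is the end of \<open>Y\<close> in the next generation. It is already
  normalised there, hence not multiplied by \<open>l\<close>.\<close>

definition xstep ::
    "real \<Rightarrow> complex \<Rightarrow> complex \<Rightarrow> complex \<Rightarrow> complex \<Rightarrow> complex set \<Rightarrow> complex set \<Rightarrow> complex set" where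
  "xstep l a c b b1 C D = ystep l a c b C D \<union> (\<lambda>z. b1 + l *\<^sub>R z) ` gstep a c C D"

text \<open>The ball of radius \<open>R\<close> is invariant. The binding case is the last piece of
  \<open>xstep\<close>, where \<open>Q + (Q + R) / 2 \<le> R\<close> amounts to
  \<open>3 * Q \<le> R\<close>.\<close>

lemma step_bound:
  assumes C: "\<And>z. z \<in> C \<Longrightarrow> norm z \<le> R" and D: "\<And>z. z \<in> D \<Longrightarrow> norm z \<le> R"
    and a: "norm a = 1" and Q: "norm c \<le> Q" "norm b \<le> Q" "norm b1 \<le> Q"
    and l: "0 \<le> l" "l \<le> 1/2" and R: "3 * Q \<le> R"
  shows "z \<in> ystep l a c b C D \<Longrightarrow> norm z \<le> R" "z \<in> xstep l a c b b1 C D \<Longrightarrow> norm z \<le> R"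
proof -
  have Q0: "0 \<le> Q" using Q(1) norm_ge_zero order_trans by blast
  have add: "norm (x + y) \<le> p + q" if "norm x \<le> p" "norm y \<le> q" for x y :: complex and p q
    using that norm_triangle_mono by blast
  have G: "norm z \<le> Q + R" if "z \<in> gstep a c C D" for z
    using that Q0 C D Q unfolding gstep_def
    by (auto simp: norm_mult a intro!: add intro: order_trans[OF C])
  have H: "norm (c + a * b + a * cnj z) \<le> (Q + Q) + R" if "z \<in> C" for z
    using that Q C by (intro add) (auto simp: norm_mult a)
  have half: "l * x \<le> x / 2" if "0 \<le> x" for x
    using mult_right_mono[OF l(2) that] by simp
  have "norm (l *\<^sub>R cnj w) \<le> R"
    if "w \<in> gstep a c C D \<union> (\<lambda>z. c + a * b + a * cnj z) ` C" for w
  proof -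
    have "norm w \<le> 2 * Q + R" using that G H Q0 by fastforce
    then show ?thesis using half[of "norm w"] l R Q0 by simp
  qed
  then show Y: "z \<in> ystep l a c b C D \<Longrightarrow> norm z \<le> R" for z unfolding ystep_def by blast
  have "norm (b1 + l *\<^sub>R w) \<le> R" if "w \<in> gstep a c C D" for w
    using add[OF Q(3), of "l *\<^sub>R w" "norm w / 2"] half[of "norm w"] l G[OF that] R by simp
  then show "z \<in> xstep l a c b b1 C D \<Longrightarrow> norm z \<le> R"
    using Y unfolding xstep_def by blast
qed

text \<open>Only the old distance \<open>e\<close> needs the contraction factor \<open>l\<close>. In
  \<open>ystep\<close>, moving the ends and rotations costs at most
  \<open>\<epsilon> * (2 + 2 * R)\<close>, and changing the scaling of points of norm at most
  \<open>3 * R\<close> costs the rest.\<close>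

lemma step_hclose:
  assumes C: "hclose e C C'" and D: "hclose e D D'"
    and R: "\<And>z. z \<in> C' \<Longrightarrow> norm z \<le> R" "\<And>z. z \<in> D' \<Longrightarrow> norm z \<le> R"
       "norm c' \<le> R" "norm b' \<le> R"
    and a: "norm a = 1" "norm a' = 1" and l: "0 \<le> l" "l \<le> 1"
    and \<epsilon>: "norm (a - a') \<le> \<epsilon>" "norm (c - c') \<le> \<epsilon>" "norm (b - b') \<le> \<epsilon>" "norm (b1 - b1') \<le> \<epsilon>"
      "\<bar>l - l'\<bar> \<le> \<epsilon>"
  shows "hclose (l * e + \<epsilon> * (2 + 5 * R)) (ystep l a c b C D) (ystep l' a' c' b' C' D')"
    and "hclose (l * e + \<epsilon> * (2 + 5 * R)) (xstep l a c b b1 C D) (xstep l' a' c' b' b1' C' D')"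
proof -
  have R0: "0 \<le> R" using R(3) norm_ge_zero order_trans by blast
  have \<epsilon>0: "0 \<le> \<epsilon>" using \<epsilon>(2) norm_ge_zero order_trans by blast
  have \<epsilon>R: "0 \<le> \<epsilon> * R" using R0 \<epsilon>0 by simp
  have add: "norm ((x + y) - (x' + y')) \<le> p + q" if "norm (x - x') \<le> p" "norm (y - y') \<le> q"
    for x x' y y' :: complex and p q
    using norm_triangle_mono[OF that] by (simp add: algebra_simps)
  have add': "norm (x + y) \<le> p + q" if "norm x \<le> p" "norm y \<le> q" for x y :: complex and p q
    using that norm_triangle_mono by blast
  let ?g = "e + \<epsilon> * (1 + R)"
  have G: "hclose ?g (gstep a c C D) (gstep a' c' C' D')"
    unfolding gstep_def
  proof (rule hclose_Un)
    show "hclose ?g C C'" using C by (rule hclose_mono) (use \<epsilon>0 R0 in simp)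
    show "hclose ?g ((\<lambda>z. c + a * z) ` D) ((\<lambda>z. c' + a' * z) ` D')"
    proof (rule hclose_image[OF D])
      fix x y assume "x \<in> D" "y \<in> D'" "dist x y \<le> e"
      then have "norm ((c + a * x) - (c' + a' * y)) \<le> \<epsilon> + (e + \<epsilon> * R)"
        using R \<epsilon> a by (intro add norm_unit_mult_diff_le) (auto simp: dist_norm)
      then show "dist (c + a * x) (c' + a' * y) \<le> ?g" by (simp add: dist_norm algebra_simps)
    qed
  qed
  have GR: "norm z \<le> 2 * R" if "z \<in> gstep a' c' C' D'" for z
  proof -
    have "norm (c' + a' * w) \<le> R + R" if "w \<in> D'" for w
      using R that by (intro add') (auto simp: norm_mult a)
    then show ?thesis using that R(1)[of z] R0 by (auto simp: gstep_def)
  qed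
  let ?h = "e + \<epsilon> * (2 + 2 * R)"
  let ?H = "gstep a c C D \<union> (\<lambda>z. c + a * b + a * cnj z) ` C"
  let ?H' = "gstep a' c' C' D' \<union> (\<lambda>z. c' + a' * b' + a' * cnj z) ` C'"
  have H: "hclose ?h ?H ?H'"
  proof (rule hclose_Un)
    show "hclose ?h (gstep a c C D) (gstep a' c' C' D')"
      using G by (rule hclose_mono) (use \<epsilon>0 \<epsilon>R in \<open>simp add: algebra_simps\<close>)
    show "hclose ?h ((\<lambda>z. c + a * b + a * cnj z) ` C) ((\<lambda>z. c' + a' * b' + a' * cnj z) ` C')"
    proof (rule hclose_image[OF C])
      fix x y assume "x \<in> C" "y \<in> C'" "dist x y \<le> e"
      then have "norm ((c + a * b + a * cnj x) - (c' + a' * b' + a' * cnj y)) \<le>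
          \<epsilon> + (\<epsilon> + \<epsilon> * R) + (e + \<epsilon> * R)"
        using R \<epsilon> a
        by (intro add norm_unit_mult_diff_le) (auto simp: dist_norm simp flip: complex_cnj_diff)
      then show "dist (c + a * b + a * cnj x) (c' + a' * b' + a' * cnj y) \<le> ?h"
        by (simp add: dist_norm algebra_simps)
    qed
  qed
  have HR: "norm z \<le> 3 * R" if "z \<in> ?H'" for z
  proof -
    have "norm (c' + a' * b' + a' * cnj w) \<le> R + R + R" if "w \<in> C'" for w
      using R that by (intro add') (auto simp: norm_mult a)
    then show ?thesis using that GR[of z] R0 by auto
  qed
  have lx: "l * x \<le> x" if "0 \<le> x" for x using mult_right_mono[OF l(2) that] by simp
  have l\<epsilon>: "l * \<epsilon> \<le> \<epsilon>" "l * (\<epsilon> * R) \<le> \<epsilon> * R" using lx \<epsilon>0 \<epsilon>R by auto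
  let ?y = "l * e + \<epsilon> * (2 + 5 * R)"
  show Y: "hclose ?y (ystep l a c b C D) (ystep l' a' c' b' C' D')"
    unfolding ystep_def
  proof (rule hclose_image[OF H])
    fix x y assume xy: "x \<in> ?H" "y \<in> ?H'" "dist x y \<le> ?h"
    then have "norm (l *\<^sub>R cnj x - l' *\<^sub>R cnj y) \<le> l * ?h + \<epsilon> * (3 * R)"
      using HR l \<epsilon> by (intro norm_scaleR_diff_le) (auto simp: dist_norm simp flip: complex_cnj_diff)
    also have "\<dots> \<le> ?y" using l\<epsilon> by (simp add: algebra_simps)
    finally show "dist (l *\<^sub>R cnj x) (l' *\<^sub>R cnj y) \<le> ?y" by (simp add: dist_norm)
  qed
  show "hclose ?y (xstep l a c b b1 C D) (xstep l' a' c' b' b1' C' D')"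
    unfolding xstep_def
  proof (rule hclose_Un[OF Y], rule hclose_image[OF G])
    fix x y assume xy: "x \<in> gstep a c C D" "y \<in> gstep a' c' C' D'" "dist x y \<le> ?g"
    then have "norm ((b1 + l *\<^sub>R x) - (b1' + l' *\<^sub>R y)) \<le> \<epsilon> + (l * ?g + \<epsilon> * (2 * R))"
      using GR l \<epsilon> by (intro add norm_scaleR_diff_le) (auto simp: dist_norm)
    also have "\<dots> \<le> ?y" using l\<epsilon> \<epsilon>R by (simp add: algebra_simps)
    finally show "dist (b1 + l *\<^sub>R x) (b1' + l' *\<^sub>R y) \<le> ?y" by (simp add: dist_norm)
  qed
qed

text \<open>Points with the same parameter are matched.\<close>

lemma hclose_segment:
  fixes p q :: "'a::real_normed_vector"
  shows "hclose (norm (p - q)) (closed_segment 0 p) (closed_segment 0 q)"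
proof -
  have "norm (u *\<^sub>R p - u *\<^sub>R q) \<le> norm (p - q)" if "0 \<le> u" "u \<le> 1" for u
    using that by (simp add: scaleR_diff_right[symmetric] mult_left_le_one_le)
  then show ?thesis
    unfolding hclose_def closed_segment_def by (simp add: dist_norm) blast
qed

lemma lead_tendsto:
  assumes "(\<mu> \<longlongrightarrow> \<mu>0) F" "\<mu>0 > 1" "\<And>k. ((\<lambda>\<alpha>. z \<alpha> k) \<longlongrightarrow> z0 k) F"
  shows "((\<lambda>\<alpha>. lead (\<mu> \<alpha>) (z \<alpha>)) \<longlongrightarrow> lead \<mu>0 z0) F"
proof -
  have "1 / \<mu>0 < 1" "1 < \<mu>0 ^ 3" using assms(2) by auto
  then have "\<mu>0 ^ 3 - 1 / \<mu>0 \<noteq> 0" by linarith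
  then have "complex_of_real (\<mu>0 ^ 3 - 1 / \<mu>0) \<noteq> 0" by (metis of_real_eq_0_iff)
  then show ?thesis
    unfolding lead_def using assms by (intro tendsto_intros) auto
qed

section \<open>The normalised system: bounds and contraction between generations\<close>

context folded_words
begin

abbreviation xlead :: "real \<Rightarrow> complex" where
  "xlead \<alpha> \<equiv> lead (growth \<alpha>) (xend \<alpha>)"

abbreviation ylead :: "real \<Rightarrow> complex" where
  "ylead \<alpha> \<equiv> lead (growth \<alpha>) (yend \<alpha>)"

definition nxend :: "real \<Rightarrow> nat \<Rightarrow> complex" where
  "nxend \<alpha> k = xend \<alpha> k /\<^sub>R growth \<alpha> ^ k"

definition nyend :: "real \<Rightarrow> nat \<Rightarrow> complex" where
  "nyend \<alpha> k = yend \<alpha> k /\<^sub>R growth \<alpha> ^ k"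

definition nxset :: "real \<Rightarrow> nat \<Rightarrow> complex set" where
  "nxset \<alpha> k = (\<lambda>z. z /\<^sub>R growth \<alpha> ^ k) ` xset \<alpha> k"

definition nyset :: "real \<Rightarrow> nat \<Rightarrow> complex set" where
  "nyset \<alpha> k = (\<lambda>z. z /\<^sub>R growth \<alpha> ^ k) ` yset \<alpha> k"

lemma gset_normalised:
  "(\<lambda>z. z /\<^sub>R growth \<alpha> ^ k) ` gset \<alpha> k = gstep (cis \<alpha>) (nxend \<alpha> k) (nxset \<alpha> k) (nyset \<alpha> k)"
  unfolding gset_def gstep_def nxset_def nyset_def image_Un image_image nxend_def
  by (simp add: scaleR_add_right)

lemma nyset_Suc: "nyset \<alpha> (Suc k) =
    ystep (inverse (growth \<alpha>)) (cis \<alpha>) (nxend \<alpha> k) (nyend \<alpha> k) (nxset \<alpha> k) (nyset \<alpha> k)"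
proof -
  let ?h = "\<lambda>z. z /\<^sub>R growth \<alpha> ^ k" and ?l = "inverse (growth \<alpha>)"
  have "cnj z /\<^sub>R growth \<alpha> ^ Suc k = ?l *\<^sub>R cnj (?h z)" for z
    by (simp add: scaleR_conv_of_real mult_ac)
  then have "nyset \<alpha> (Suc k) = (\<lambda>z. ?l *\<^sub>R cnj z) ` (?h ` (gset \<alpha> k \<union>
      (\<lambda>z. xend \<alpha> k + cis \<alpha> * yend \<alpha> k + cis \<alpha> * cnj z) ` xset \<alpha> k))"
    unfolding nyset_def yset_Suc image_image by simp
  also have "?h ` ((\<lambda>z. xend \<alpha> k + cis \<alpha> * yend \<alpha> k + cis \<alpha> * cnj z) ` xset \<alpha> k) =
      (\<lambda>z. nxend \<alpha> k + cis \<alpha> * nyend \<alpha> k + cis \<alpha> * cnj z) ` nxset \<alpha> k"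
    unfolding nxset_def image_image nxend_def nyend_def
    by (simp add: scaleR_conv_of_real distrib_left mult_ac)
  then have "?h ` (gset \<alpha> k \<union>
      (\<lambda>z. xend \<alpha> k + cis \<alpha> * yend \<alpha> k + cis \<alpha> * cnj z) ` xset \<alpha> k) =
      gstep (cis \<alpha>) (nxend \<alpha> k) (nxset \<alpha> k) (nyset \<alpha> k) \<union>
      (\<lambda>z. nxend \<alpha> k + cis \<alpha> * nyend \<alpha> k + cis \<alpha> * cnj z) ` nxset \<alpha> k"
    unfolding image_Un gset_normalised by simp
  finally show ?thesis unfolding ystep_def .
qed

lemma nxset_Suc: "nxset \<alpha> (Suc k) =
    xstep (inverse (growth \<alpha>)) (cis \<alpha>) (nxend \<alpha> k) (nyend \<alpha> k) (nyend \<alpha> (Suc k))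
      (nxset \<alpha> k) (nyset \<alpha> k)"
proof -
  let ?l = "inverse (growth \<alpha>)"
  have "(yend \<alpha> (Suc k) + z) /\<^sub>R growth \<alpha> ^ Suc k = nyend \<alpha> (Suc k) + ?l *\<^sub>R (z /\<^sub>R growth \<alpha> ^ k)" for z
    by (simp add: nyend_def scaleR_add_right)
  then have "nxset \<alpha> (Suc k) = nyset \<alpha> (Suc k) \<union>
      (\<lambda>z. nyend \<alpha> (Suc k) + ?l *\<^sub>R z) ` ((\<lambda>z. z /\<^sub>R growth \<alpha> ^ k) ` gset \<alpha> k)"
    unfolding nxset_def xset_Suc image_Un image_image nyset_def by simp
  then show ?thesis unfolding gset_normalised xstep_def nyset_Suc .
qed

lemma sets_nonempty: "nxset \<alpha> k \<noteq> {}" "nyset \<alpha> k \<noteq> {}"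
  by (simp_all add: nxset_def xset_def nyset_def yset_def polyline_nonempty X_nonempty Y_nonempty)

lemma sets_bounded: "bounded (nxset \<alpha> k)" "bounded (nyset \<alpha> k)"
  unfolding nxset_def xset_def nyset_def yset_def
  by (intro bounded_scaling bounded_linear_image[OF _ bounded_linear_mult_right] polyline_bounded)+

text \<open>By \<open>lead_approx\<close> the deviation from the leading term stays bounded, and it
  is divided by \<open>growth \<alpha> ^ k\<close>, which is at least \<open>2 ^ k\<close>.\<close>

lemma ends_approx:
  assumes "growth \<alpha> \<ge> 2"
  shows "\<exists>B>0. \<forall>k. norm (nxend \<alpha> k - xlead \<alpha>) \<le> B * (1/2) ^ k \<and>
    norm (nyend \<alpha> k - ylead \<alpha>) \<le> B * (1/2) ^ k"
proof -
  let ?g = "growth \<alpha>"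
  have approx: "\<exists>B>0. \<forall>k. norm (z k /\<^sub>R ?g ^ k - lead ?g z) \<le> B * (1/2) ^ k"
    if rec: "\<And>k. z (k + 4) = of_real (2 + 2 * cos \<alpha>) * z (k + 3) + 2 * z (k + 2)
           - of_real (2 + 2 * cos \<alpha>) * z (k + 1) - z k" for z
  proof -
    obtain B where B: "B > 0" "\<And>k. norm (z k - ?g ^ k *\<^sub>R lead ?g z) \<le> B"
      using lead_approx[OF rec, of ?g] assms growth_eq[of \<alpha>] by auto
    have "norm (z k /\<^sub>R ?g ^ k - lead ?g z) \<le> B * (1/2) ^ k" for k
    proof -
      have "z k /\<^sub>R ?g ^ k - lead ?g z = (z k - ?g ^ k *\<^sub>R lead ?g z) /\<^sub>R ?g ^ k"
        using assms by (simp add: scaleR_diff_right)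
      then have "norm (z k /\<^sub>R ?g ^ k - lead ?g z) = norm (z k - ?g ^ k *\<^sub>R lead ?g z) * inverse ?g ^ k"
        using assms by (simp add: power_inverse divide_inverse mult.commute)
      also have "\<dots> \<le> B * (1/2) ^ k"
      proof (intro mult_mono power_mono)
        show "inverse ?g \<le> 1/2" using assms le_imp_inverse_le[of 2 ?g] by simp
      qed (use B assms in auto)
      finally show ?thesis .
    qed
    with B show ?thesis by blast
  qed
  obtain B1 B2 where B: "B1 > 0" "\<And>k. norm (nxend \<alpha> k - xlead \<alpha>) \<le> B1 * (1/2) ^ k"
      "B2 > 0" "\<And>k. norm (nyend \<alpha> k - ylead \<alpha>) \<le> B2 * (1/2) ^ k"
    using approx[OF end_recurrence(1)] approx[OF end_recurrence(2)]
    unfolding nxend_def nyend_def by auto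
  show ?thesis
  proof (intro exI[of _ "max B1 B2"] conjI allI)
    show "norm (nxend \<alpha> k - xlead \<alpha>) \<le> max B1 B2 * (1/2) ^ k" for k
      using order_trans[OF B(2)[of k] mult_right_mono[of B1 "max B1 B2"]] by simp
    show "norm (nyend \<alpha> k - ylead \<alpha>) \<le> max B1 B2 * (1/2) ^ k" for k
      using order_trans[OF B(4)[of k] mult_right_mono[of B2 "max B1 B2"]] by simp
  qed (use B in auto)
qed

lemma ends_tendsto:
  assumes "growth \<alpha> \<ge> 2"
  shows "nxend \<alpha> \<longlonglongrightarrow> xlead \<alpha>" "nyend \<alpha> \<longlonglongrightarrow> ylead \<alpha>"
proof -
  obtain B where "B > 0" and B: "\<And>k. norm (nxend \<alpha> k - xlead \<alpha>) \<le> B * (1/2) ^ k"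
    "\<And>k. norm (nyend \<alpha> k - ylead \<alpha>) \<le> B * (1/2) ^ k"
    using ends_approx[OF assms] by blast
  have lim: "(\<lambda>k. B * (1/2::real) ^ k) \<longlonglongrightarrow> 0"
    by (intro tendsto_mult_right_zero LIMSEQ_power_zero) auto
  show "nxend \<alpha> \<longlonglongrightarrow> xlead \<alpha>" "nyend \<alpha> \<longlonglongrightarrow> ylead \<alpha>"
    by (rule LIM_zero_cancel, rule Lim_null_comparison[OF always_eventually lim], use B in blast)+
qed

lemma uniformly_bounded:
  assumes g: "growth \<alpha> \<ge> 2"
  shows "\<exists>R>0. \<forall>k. norm (nxend \<alpha> k) \<le> R \<and> norm (nyend \<alpha> k) \<le> R \<and>
    (\<forall>z\<in>nxset \<alpha> k. norm z \<le> R) \<and> (\<forall>z\<in>nyset \<alpha> k. norm z \<le> R)"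
proof -
  have "Bseq (nxend \<alpha>)" "Bseq (nyend \<alpha>)"
    using convergent_imp_Bseq[OF convergentI] ends_tendsto[OF g] by blast+
  then obtain Q1 Q2 where Q12: "\<And>k. norm (nxend \<alpha> k) \<le> Q1" "\<And>k. norm (nyend \<alpha> k) \<le> Q2"
    unfolding Bseq_def by blast
  obtain R1 R2 where R12: "\<And>z. z \<in> nxset \<alpha> 0 \<Longrightarrow> norm z \<le> R1" "\<And>z. z \<in> nyset \<alpha> 0 \<Longrightarrow> norm z \<le> R2"
    using sets_bounded[of \<alpha> 0] unfolding bounded_iff by blast
  define Q where "Q = max 1 (max Q1 Q2)"
  define R where "R = max (3 * Q) (max R1 R2)"
  have Q: "norm (nxend \<alpha> k) \<le> Q" "norm (nyend \<alpha> k) \<le> Q" for k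
    using Q12[of k] by (auto simp: Q_def)
  have QR: "0 < Q" "3 * Q \<le> R" by (auto simp: Q_def R_def)
  have l: "0 \<le> inverse (growth \<alpha>)" "inverse (growth \<alpha>) \<le> 1/2"
    using g le_imp_inverse_le[of 2 "growth \<alpha>"] by auto
  have S: "(\<forall>z\<in>nxset \<alpha> k. norm z \<le> R) \<and> (\<forall>z\<in>nyset \<alpha> k. norm z \<le> R)" for k
  proof (induction k)
    case 0
    show ?case using R12 by (fastforce simp: R_def)
  next
    case (Suc k)
    then have "\<And>z. z \<in> nxset \<alpha> k \<Longrightarrow> norm z \<le> R" "\<And>z. z \<in> nyset \<alpha> k \<Longrightarrow> norm z \<le> R" by auto
    note b = step_bound[OF this norm_cis Q(1)[of k] Q(2)[of k] Q(2)[of "Suc k"] l QR(2)]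
    show ?case unfolding nxset_Suc nyset_Suc using b by auto
  qed
  have "Q \<le> R" using QR by simp
  then show ?thesis
    using S Q QR by (intro exI[of _ R]) (auto intro: order_trans[of _ Q])
qed

text \<open>Used twice: with equal angles and \<open>k' = Suc k\<close> to compare consecutive
  generations, and with \<open>\<alpha>' = 0\<close> and \<open>k' = k\<close> to compare with the
  straight curves.\<close>

lemma next_sets_hclose:
  assumes "hclose e (nxset \<alpha> k) (nxset \<alpha>' k')" "hclose e (nyset \<alpha> k) (nyset \<alpha>' k')"
    and "\<And>z. z \<in> nxset \<alpha>' k' \<Longrightarrow> norm z \<le> R" "\<And>z. z \<in> nyset \<alpha>' k' \<Longrightarrow> norm z \<le> R"
      "norm (nxend \<alpha>' k') \<le> R" "norm (nyend \<alpha>' k') \<le> R"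
    and g: "growth \<alpha> \<ge> 2"
    and "norm (cis \<alpha> - cis \<alpha>') \<le> \<epsilon>" "norm (nxend \<alpha> k - nxend \<alpha>' k') \<le> \<epsilon>"
      "norm (nyend \<alpha> k - nyend \<alpha>' k') \<le> \<epsilon>" "norm (nyend \<alpha> (Suc k) - nyend \<alpha>' (Suc k')) \<le> \<epsilon>"
      "\<bar>inverse (growth \<alpha>) - inverse (growth \<alpha>')\<bar> \<le> \<epsilon>"
    and e: "e / 2 + \<epsilon> * (2 + 5 * R) \<le> e'"
  shows "hclose e' (nxset \<alpha> (Suc k)) (nxset \<alpha>' (Suc k'))"
    "hclose e' (nyset \<alpha> (Suc k)) (nyset \<alpha>' (Suc k'))"
proof -
  have l: "0 \<le> inverse (growth \<alpha>)" "inverse (growth \<alpha>) \<le> 1/2"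
    using g le_imp_inverse_le[of 2 "growth \<alpha>"] by auto
  obtain z where "z \<in> nxset \<alpha> k" using sets_nonempty by blast
  then have "0 \<le> e"
    using assms(1) unfolding hclose_def by (meson order_trans zero_le_dist)
  then have "inverse (growth \<alpha>) * e \<le> e / 2" using mult_right_mono[OF l(2)] by simp
  then have e'': "inverse (growth \<alpha>) * e + \<epsilon> * (2 + 5 * R) \<le> e'" using e by simp
  have l1: "inverse (growth \<alpha>) \<le> 1" using l(2) by simp
  note h = step_hclose[OF assms(1-6) norm_cis norm_cis l(1) l1 assms(8-12)]
  show "hclose e' (nxset \<alpha> (Suc k)) (nxset \<alpha>' (Suc k'))"
    unfolding nxset_Suc using hclose_mono[OF h(2) e''] .
  show "hclose e' (nyset \<alpha> (Suc k)) (nyset \<alpha>' (Suc k'))"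
    unfolding nyset_Suc using hclose_mono[OF h(1) e''] .
qed

text \<open>Distances are halved in each generation while the new errors also decay like
  \<open>(1/2) ^ k\<close>, which could build up a factor \<open>k\<close>; the slower rate
  \<open>3/4\<close> absorbs it.\<close>

lemma consecutive_hclose:
  assumes g: "growth \<alpha> \<ge> 2"
  obtains M where "M > 0" "\<And>k. hclose (M * (3/4) ^ k) (nxset \<alpha> k) (nxset \<alpha> (Suc k))"
proof -
  obtain B where B: "B > 0" "\<And>k. norm (nxend \<alpha> k - xlead \<alpha>) \<le> B * (1/2) ^ k"
    "\<And>k. norm (nyend \<alpha> k - ylead \<alpha>) \<le> B * (1/2) ^ k"
    using ends_approx[OF g] by blast
  obtain R where R: "R > 0" "\<And>k. norm (nxend \<alpha> k) \<le> R" "\<And>k. norm (nyend \<alpha> k) \<le> R"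
    "\<And>k z. z \<in> nxset \<alpha> k \<Longrightarrow> norm z \<le> R" "\<And>k z. z \<in> nyset \<alpha> k \<Longrightarrow> norm z \<le> R"
    using uniformly_bounded[OF g] by blast
  have diff: "norm (z k - z (Suc k)) \<le> 2 * B * (1/2) ^ k"
    if "\<And>k. norm (z k - p) \<le> B * (1/2) ^ k" for z :: "nat \<Rightarrow> complex" and p k
  proof -
    have "norm (z k - z (Suc k)) \<le> norm (z k - p) + norm (z (Suc k) - p)"
      using norm_triangle_ineq4[of "z k - p" "z (Suc k) - p"] by simp
    also have "\<dots> \<le> B * (1/2) ^ k + B * (1/2) ^ Suc k" using that add_mono by blast
    also have "\<dots> \<le> 2 * B * (1/2) ^ k" using B(1) by simp
    finally show ?thesis .
  qed
  \<comment> \<open>\<open>2 * R\<close> covers generation 0. The other summand keeps the new error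
    below \<open>M / 4 * (3/4) ^ k\<close>, and \<open>M / 2 + M / 4\<close> is \<open>3/4\<close>
    of \<open>M\<close>.\<close>
  define M where "M = 2 * R + 8 * B * (2 + 5 * R)"
  have M: "M > 0" using B(1) R(1) by (simp add: M_def add_pos_pos)
  have "hclose (M * (3/4) ^ k) (nxset \<alpha> k) (nxset \<alpha> (Suc k)) \<and>
        hclose (M * (3/4) ^ k) (nyset \<alpha> k) (nyset \<alpha> (Suc k))" for k
  proof (induction k)
    case 0
    have "R + R \<le> M" using B(1) R(1) by (simp add: M_def)
    moreover have "hclose (R + R) (nxset \<alpha> 0) (nxset \<alpha> (Suc 0))"
      by (rule hclose_bounded[OF R(4) R(4) sets_nonempty(1) sets_nonempty(1)])
    moreover have "hclose (R + R) (nyset \<alpha> 0) (nyset \<alpha> (Suc 0))"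
      by (rule hclose_bounded[OF R(5) R(5) sets_nonempty(2) sets_nonempty(2)])
    ultimately show ?case using hclose_mono by (metis mult.right_neutral power_0)
  next
    case (Suc k)
    let ?e = "M * (3/4) ^ k" and ?\<epsilon> = "2 * B * (1/2) ^ k"
    have 1: "norm (nyend \<alpha> (Suc k) - nyend \<alpha> (Suc (Suc k))) \<le> ?\<epsilon>"
    proof -
      have "2 * B * (1/2) ^ Suc k \<le> ?\<epsilon>" using B(1) by simp
      then show ?thesis using diff[of "nyend \<alpha>" "ylead \<alpha>" "Suc k", OF B(3)] by linarith
    qed
    have 2: "?e / 2 + ?\<epsilon> * (2 + 5 * R) \<le> M * (3/4) ^ Suc k"
    proof -
      have "2 * B * (2 + 5 * R) * (1/2) ^ k \<le> (M / 4) * (3/4) ^ k"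
        using B(1) R(1) by (intro mult_mono power_mono) (auto simp: M_def)
      then show ?thesis by (simp add: algebra_simps)
    qed
    have 3: "norm (cis \<alpha> - cis \<alpha>) \<le> ?\<epsilon>" "\<bar>inverse (growth \<alpha>) - inverse (growth \<alpha>)\<bar> \<le> ?\<epsilon>"
      using B(1) by simp_all
    note next_sets_hclose[OF conjunct1[OF Suc] conjunct2[OF Suc] R(4) R(5) R(2) R(3) g 3(1)
        diff[of "nxend \<alpha>" "xlead \<alpha>" k, OF B(2)] diff[of "nyend \<alpha>" "ylead \<alpha>" k, OF B(3)] 1 3(2) 2]
    then show ?case ..
  qed
  with M that show thesis by blast
qed

section \<open>Comparison with angle 0\<close>

lemma ends_tendsto_zero:
  "((\<lambda>\<alpha>. xend \<alpha> k) \<longlongrightarrow> xend 0 k) (at_right 0)" "((\<lambda>\<alpha>. yend \<alpha> k) \<longlongrightarrow> yend 0 k) (at_right 0)"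
  unfolding xend_def yend_def rot_def pos_def by (intro tendsto_intros; simp)+

lemma leads_tendsto_zero:
  "(xlead \<longlongrightarrow> xlead 0) (at_right 0)" "(ylead \<longlongrightarrow> ylead 0) (at_right 0)"
  using growth_zero_gt by (auto intro!: lead_tendsto growth_tendsto ends_tendsto_zero)

lemma xend_zero: "xend 0 k = of_nat (length (X k))"
  by (simp add: xend_def rot_def pos_zero_angle)

lemma nxset_zero: "nxset 0 k = closed_segment 0 (nxend 0 k)"
proof -
  have "linear (\<lambda>z::complex. z /\<^sub>R growth 0 ^ k)"
    by (rule linearI) (auto simp: scaleR_add_right)
  from closed_segment_linear_image[OF this, of 0 "xend 0 k"] show ?thesis
    by (simp add: nxset_def xset_def rot_def polyline_zero_angle X_nonempty nxend_def xend_zero)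
qed

text \<open>At angle 0 the ends are word lengths, which increase strictly, so both differences in
  the numerator of \<open>lead\<close> are positive.\<close>

lemma xlead_zero: obtains p where "p > 0" "xlead 0 = of_real p"
proof -
  let ?g = "growth 0"
  have len: "length (X (Suc k)) > length (X k)" for k
    using parity(2)[of k] X_nonempty[of k] by (simp add: X_Suc Y_Suc)
  have "1 / ?g < 1" "1 < ?g ^ 3" using growth_zero_gt by auto
  then have "0 < ?g ^ 3 - 1 / ?g" by linarith
  moreover have "length (X 3) > length (X 1)" "length (X 2) > length (X 0)"
    using len[of 0] len[of 1] len[of 2] by (simp_all add: numeral_eq_Suc)
  then have "0 < real (length (X 3)) + length (X 2) / ?g - length (X 1) - length (X 0) / ?g"
    using growth_zero_gt by (simp add: add_pos_pos diff_divide_distrib[symmetric] divide_strict_right_mono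
        add_strict_mono algebra_simps)
  ultimately show thesis
    using that[of "(real (length (X 3)) + length (X 2) / ?g - length (X 1) - length (X 0) / ?g)
        / (?g ^ 3 - 1 / ?g)"]
    by (simp add: lead_def xend_zero)
qed

lemma attractor_exists:
  assumes "growth \<alpha> \<ge> 2"
  obtains K M where "compact K" "K \<noteq> {}" "\<And>k. hclose (M * (3/4) ^ k) (nxset \<alpha> k) K"
proof -
  obtain M where M: "M > 0" "\<And>k. hclose (M * (3/4) ^ k) (nxset \<alpha> k) (nxset \<alpha> (Suc k))"
    using consecutive_hclose[OF assms] by blast
  obtain K where "compact K" "K \<noteq> {}"
      "\<And>k. hclose (2 * M / (1 - 3/4) * (3/4) ^ k) (nxset \<alpha> k) K"
    by (rule hclose_geometric_limit[OF M(2) sets_nonempty(1) sets_bounded(1) M(1)]) auto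
  then show thesis using that by blast
qed

lemma eventually_growth: "\<forall>\<^sub>F \<alpha> in at_right 0. growth \<alpha> \<ge> 2"
  using order_tendstoD(1)[OF growth_tendsto growth_zero_gt] by eventually_elim simp

text \<open>Late in the recursion all coefficients for \<open>\<alpha>\<close> are close to those
  for 0, and the contraction forgets the distance accumulated before. The stage from which this
  holds may depend on \<open>\<alpha>\<close>.\<close>

lemma hclose_zero_angle:
  assumes "\<eta> > 0"
  shows "\<forall>\<^sub>F \<alpha> in at_right 0. \<forall>\<^sub>F k in sequentially. hclose \<eta> (nxset \<alpha> k) (nxset 0 k)"
proof -
  have g0: "growth 0 \<ge> 2" using growth_zero_gt by simp
  obtain R where R: "R > 0" "\<And>k. norm (nxend 0 k) \<le> R" "\<And>k. norm (nyend 0 k) \<le> R"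
    "\<And>k z. z \<in> nxset 0 k \<Longrightarrow> norm z \<le> R" "\<And>k z. z \<in> nyset 0 k \<Longrightarrow> norm z \<le> R"
    using uniformly_bounded[OF g0] by blast
  \<comment> \<open>Chosen so that each generation adds an error of at most
    \<open>\<eta> / 4\<close>.\<close>
  define \<epsilon> where "\<epsilon> = \<eta> / 4 / (2 + 5 * R)"
  have R': "2 + 5 * R > 0" using R(1) by simp
  then have \<epsilon>: "\<epsilon> > 0" "\<epsilon> * (2 + 5 * R) = \<eta> / 4"
    using assms nonzero_eq_divide_eq[of "2 + 5 * R" \<epsilon> "\<eta> / 4"] by (simp_all add: \<epsilon>_def)
  have "\<forall>\<^sub>F \<alpha> in at_right 0. dist (cis \<alpha>) (cis 0) < \<epsilon>"
    by (intro tendstoD \<epsilon>) (intro tendsto_intros)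
  moreover have "\<forall>\<^sub>F \<alpha> in at_right 0. dist (inverse (growth \<alpha>)) (inverse (growth 0)) < \<epsilon>"
    by (intro tendstoD \<epsilon> tendsto_inverse growth_tendsto) (use growth_zero_gt in simp)
  moreover have "\<epsilon> / 3 > 0" using \<epsilon>(1) by simp
  then have "\<forall>\<^sub>F \<alpha> in at_right 0. dist (xlead \<alpha>) (xlead 0) < \<epsilon> / 3"
    "\<forall>\<^sub>F \<alpha> in at_right 0. dist (ylead \<alpha>) (ylead 0) < \<epsilon> / 3"
    using tendstoD[OF leads_tendsto_zero(1)] tendstoD[OF leads_tendsto_zero(2)] by blast+
  ultimately show ?thesis using eventually_growth
  proof eventually_elim
    case (elim \<alpha>)
    note g = \<open>growth \<alpha> \<ge> 2\<close>
    \<comment> \<open>Three thirds: from the end to its limit, between the two limits, and from the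
      second limit to its end.\<close>
    have ev: "\<forall>\<^sub>F k in sequentially. norm (u k - v k) \<le> \<epsilon>"
      if "u \<longlonglongrightarrow> p" "v \<longlonglongrightarrow> q" "dist p q < \<epsilon> / 3" for u v :: "nat \<Rightarrow> complex" and p q
    proof -
      have "\<epsilon> / 3 > 0" using \<epsilon>(1) by simp
      then have "\<forall>\<^sub>F k in sequentially. dist (u k) p < \<epsilon> / 3" "\<forall>\<^sub>F k in sequentially. dist (v k) q < \<epsilon> / 3"
        using that tendstoD by blast+
      then show ?thesis
      proof eventually_elim
        case (elim k)
        have "dist (u k) (v k) \<le> dist (u k) p + dist p q + dist q (v k)"
          using dist_triangle[of "u k" "v k" p] dist_triangle[of p "v k" q] by linarith
        then show ?case using elim that(3) by (simp add: dist_norm norm_minus_commute)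
      qed
    qed
    have "\<forall>\<^sub>F k in sequentially. norm (nxend \<alpha> k - nxend 0 k) \<le> \<epsilon> \<and> norm (nyend \<alpha> k - nyend 0 k) \<le> \<epsilon>"
      using ev[OF ends_tendsto(1)[OF g] ends_tendsto(1)[OF g0]] ev[OF ends_tendsto(2)[OF g] ends_tendsto(2)[OF g0]]
        elim by (intro eventually_conj) auto
    then obtain N where N: "\<And>k. k \<ge> N \<Longrightarrow> norm (nxend \<alpha> k - nxend 0 k) \<le> \<epsilon>"
        "\<And>k. k \<ge> N \<Longrightarrow> norm (nyend \<alpha> k - nyend 0 k) \<le> \<epsilon>"
      unfolding eventually_sequentially by blast
    have d: "norm (cis \<alpha> - cis 0) \<le> \<epsilon>" "\<bar>inverse (growth \<alpha>) - inverse (growth 0)\<bar> \<le> \<epsilon>"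
      using elim by (simp_all add: dist_norm)
    obtain S where S: "S > 0" "\<And>k z. z \<in> nxset \<alpha> k \<Longrightarrow> norm z \<le> S" "\<And>k z. z \<in> nyset \<alpha> k \<Longrightarrow> norm z \<le> S"
      using uniformly_bounded[OF g] by blast
    \<comment> \<open>\<open>\<eta> / 2\<close> is the fixed point of
      \<open>t \<mapsto> t / 2 + \<eta> / 4\<close>; the initial excess, at most
      \<open>S + R\<close>, is halved in each generation.\<close>
    have close: "hclose ((S + R) * (1/2) ^ j + \<eta> / 2) (nxset \<alpha> (N + j)) (nxset 0 (N + j)) \<and>
        hclose ((S + R) * (1/2) ^ j + \<eta> / 2) (nyset \<alpha> (N + j)) (nyset 0 (N + j))" for j
    proof (induction j)
      case 0
      have "S + R \<le> (S + R) * (1/2) ^ 0 + \<eta> / 2" using assms by simp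
      moreover have "hclose (S + R) (nxset \<alpha> (N + 0)) (nxset 0 (N + 0))"
        by (rule hclose_bounded[OF S(2) R(4) sets_nonempty(1) sets_nonempty(1)])
      moreover have "hclose (S + R) (nyset \<alpha> (N + 0)) (nyset 0 (N + 0))"
        by (rule hclose_bounded[OF S(3) R(5) sets_nonempty(2) sets_nonempty(2)])
      ultimately show ?case using hclose_mono by blast
    next
      case (Suc j)
      have e: "((S + R) * (1/2) ^ j + \<eta> / 2) / 2 + \<epsilon> * (2 + 5 * R) \<le> (S + R) * (1/2) ^ Suc j + \<eta> / 2"
        unfolding \<epsilon>(2) by (simp add: add_divide_distrib)
      have "N + j \<ge> N" "Suc (N + j) \<ge> N" by simp_all
      from next_sets_hclose[OF conjunct1[OF Suc] conjunct2[OF Suc] R(4) R(5) R(2) R(3) g d(1)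
          N(1)[OF this(1)] N(2)[OF this(1)] N(2)[OF this(2)] d(2) e]
      show ?case by simp
    qed
    have "(\<lambda>j. (S + R) * (1/2::real) ^ j) \<longlonglongrightarrow> 0"
      by (intro tendsto_mult_right_zero LIMSEQ_power_zero) auto
    then obtain J where J: "\<And>j. j \<ge> J \<Longrightarrow> (S + R) * (1/2) ^ j < \<eta> / 2"
      using order_tendstoD(2)[of _ 0 sequentially "\<eta> / 2"] assms unfolding eventually_sequentially
      by (metis half_gt_zero)
    have "hclose \<eta> (nxset \<alpha> k) (nxset 0 k)" if "k \<ge> N + J" for k
    proof -
      have "k = N + (k - N)" "k - N \<ge> J" using that by simp_all
      then show ?thesis
        using hclose_mono[OF conjunct1[OF close[of "k - N"]], of \<eta>] J[of "k - N"] by simp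
    qed
    then show ?case unfolding eventually_sequentially by blast
  qed
qed

text \<open>Three errors of \<open>\<eta> / 3\<close>: from \<open>K\<close> to a late generation,
  from angle \<open>\<alpha>\<close> to angle 0, and from that segment to its limit. Quantifying
  over all \<open>K\<close> and \<open>M\<close> keeps the set of good angles independent of how
  attractors are chosen.\<close>

lemma attractor_hclose_segment:
  assumes "\<eta> > 0"
  shows "\<forall>\<^sub>F \<alpha> in at_right 0. \<forall>K M. (\<forall>k. hclose (M * (3/4) ^ k) (nxset \<alpha> k) K) \<longrightarrow>
           hclose \<eta> K (closed_segment 0 (xlead 0))"
proof -
  have \<eta>3: "\<eta> / 3 > 0" using assms by simp
  have g0: "growth 0 \<ge> 2" using growth_zero_gt by simp
  have seg: "\<forall>\<^sub>F k in sequentially. hclose (\<eta> / 3) (nxset 0 k) (closed_segment 0 (xlead 0))"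
    using tendstoD[OF ends_tendsto(1)[OF g0] \<eta>3]
  proof eventually_elim
    case (elim k)
    then show ?case unfolding nxset_zero
      using hclose_mono[OF hclose_segment[of "nxend 0 k" "xlead 0"], of "\<eta> / 3"] by (simp add: dist_norm)
  qed
  show ?thesis using hclose_zero_angle[OF \<eta>3]
  proof (eventually_elim, intro allI impI)
    fix \<alpha> K M
    assume close: "\<forall>\<^sub>F k in sequentially. hclose (\<eta> / 3) (nxset \<alpha> k) (nxset 0 k)"
      and K: "\<forall>k. hclose (M * (3/4) ^ k) (nxset \<alpha> k) K"
    have "(\<lambda>k. M * (3/4::real) ^ k) \<longlonglongrightarrow> 0"
      by (intro tendsto_mult_right_zero LIMSEQ_power_zero) auto
    then have "\<forall>\<^sub>F k in sequentially. M * (3/4) ^ k < \<eta> / 3"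
      using \<eta>3 by (rule order_tendstoD(2))
    with seg close have "\<forall>\<^sub>F k in sequentially. hclose \<eta> K (closed_segment 0 (xlead 0))"
    proof eventually_elim
      case (elim k)
      have "hclose (\<eta> / 3) K (nxset \<alpha> k)"
        using hclose_sym K hclose_mono elim(3) less_imp_le by metis
      from hclose_trans[OF hclose_trans[OF this elim(2)] elim(1)] show ?case by simp
    qed
    then show "hclose \<eta> K (closed_segment 0 (xlead 0))" by simp
  qed
qed

end

subsection \<open>The fractal and its limit\<close>

lemma to_plane_mult_hclose:
  assumes "hclose e A B" "\<And>z. z \<in> B \<Longrightarrow> norm z \<le> R"
  shows "hclose (norm d * e + norm (d - d') * R)
     ((\<lambda>z. to_plane (d * z)) ` A) ((\<lambda>z. to_plane (d' * z)) ` B)"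
  using assms(1)
proof (rule hclose_image)
  fix x y assume "x \<in> A" "y \<in> B" "dist x y \<le> e"
  then show "dist (to_plane (d * x)) (to_plane (d' * y)) \<le> norm d * e + norm (d - d') * R"
    using norm_mult_diff_le[of x y e d d' "norm (d - d')" R] assms(2)
    by (simp add: dist_norm[of "d * x"] dist_norm[of x])
qed

context folded_words
begin

text \<open>Undoes \<open>rot\<close> at even generations and rescales the distance between the
  first and last vertex to \<open>sqrt 2\<close>.\<close>

definition dilation :: "real \<Rightarrow> complex" where
  "dilation \<alpha> = of_real (sqrt 2 / norm (xlead \<alpha>)) * cis (s * \<alpha> / 2)"

text \<open>At an even generation the angle is \<open>\<alpha>\<close> itself, so no reflection
  remains; the powers of \<open>growth \<alpha>\<close> cancel in the quotient. This is why
  \<open>mk\<close> advances by 6, that is, by two generations.\<close>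

lemma scaled_curve_eq_nxset:
  assumes fib: "fibw i n = X (2 * k)" and g: "growth \<alpha> \<ge> 2"
  shows "scaled_curve i \<alpha> n =
    (\<lambda>z. to_plane (of_real (sqrt 2 / norm (nxend \<alpha> (2 * k))) * cis (s * \<alpha> / 2) * z)) ` nxset \<alpha> (2 * k)"
proof -
  let ?g = "growth \<alpha> ^ (2 * k)" and ?w = "endpt \<alpha> (X (2 * k))"
  have gpos: "?g > 0" using g by simp
  have rot: "rot \<alpha> (2 * k) = cis (- (s * \<alpha> / 2))" by (simp add: rot_def)
  have "norm (nxend \<alpha> (2 * k)) = norm ?w / ?g"
    unfolding nxend_def xend_def rot using gpos by (simp add: norm_mult field_simps)
  then have "sqrt 2 / norm (nxend \<alpha> (2 * k)) / ?g = sqrt 2 / norm ?w" using g by auto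
  moreover have "cis (s * \<alpha> / 2) * cis (- (s * \<alpha> / 2)) = 1" by (simp add: cis_mult)
  then have "cis (s * \<alpha> / 2) * (rot \<alpha> (2 * k) * z) = z" for z
    unfolding rot by (simp flip: mult.assoc)
  moreover have "of_real c * e * (z /\<^sub>R ?g) = (c / ?g) *\<^sub>R (e * z)" for c :: real and e z :: complex
    by (simp add: scaleR_conv_of_real divide_inverse mult_ac)
  ultimately have "of_real (sqrt 2 / norm (nxend \<alpha> (2 * k))) * cis (s * \<alpha> / 2) *
      ((rot \<alpha> (2 * k) * z) /\<^sub>R ?g) = (sqrt 2 / norm ?w) *\<^sub>R z" for z
    by (simp only:)
  then show ?thesis
    unfolding scaled_curve_eq fib nxset_def xset_def image_image by simp
qed

text \<open>The rescaling factors converge because the normalised ends tend to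
  \<open>xlead \<alpha>\<close>, which is nonzero. The image of the attractor is therefore a
  Hausdorff limit, and uniqueness identifies it with the fractal.\<close>

lemma fib_fractal_eq:
  assumes fib: "\<And>k. fibw i (mk i k) = X (2 * k)" and g: "growth \<alpha> \<ge> 2"
    and \<alpha>: "\<alpha> \<noteq> 0" and nz: "xlead \<alpha> \<noteq> 0"
    and K: "compact K" "K \<noteq> {}" "\<And>k. hclose (M * (3/4) ^ k) (nxset \<alpha> k) K"
  shows "fib_fractal i \<alpha> = (\<lambda>z. to_plane (dilation \<alpha> * z)) ` K"
proof -
  define d where "d k = of_real (sqrt 2 / norm (nxend \<alpha> (2 * k))) * cis (s * \<alpha> / 2)" for k
  have sc: "scaled_curve i \<alpha> (mk i k) = (\<lambda>z. to_plane (d k * z)) ` nxset \<alpha> (2 * k)" for k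
    unfolding d_def by (rule scaled_curve_eq_nxset[OF fib g])
  have "(\<lambda>k. nxend \<alpha> (2 * k)) \<longlonglongrightarrow> xlead \<alpha>"
    using LIMSEQ_subseq_LIMSEQ[OF ends_tendsto(1)[OF g], of "(*) 2"]
    by (simp add: o_def strict_mono_def)
  then have d: "d \<longlonglongrightarrow> dilation \<alpha>"
    unfolding d_def dilation_def using nz by (intro tendsto_intros) auto
  obtain R where R: "\<And>z. z \<in> K \<Longrightarrow> norm z \<le> R"
    using compact_imp_bounded[OF K(1)] unfolding bounded_iff by blast
  let ?L = "(\<lambda>z. to_plane (dilation \<alpha> * z)) ` K"
  let ?e = "\<lambda>k. norm (d k) * (M * (3/4) ^ (2 * k)) + norm (d k - dilation \<alpha>) * R"
  have close: "hclose (?e k) (scaled_curve i \<alpha> (mk i k)) ?L" for k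
    unfolding sc by (rule to_plane_mult_hclose[OF K(3) R])
  have ne: "scaled_curve i \<alpha> (mk i k) \<noteq> {}" for k unfolding sc using sets_nonempty by simp
  have bd: "bounded (scaled_curve i \<alpha> (mk i k))" for k
  proof -
    obtain S where "\<And>z. z \<in> nxset \<alpha> (2 * k) \<Longrightarrow> norm z \<le> S"
      using sets_bounded(1) unfolding bounded_iff by blast
    then show ?thesis unfolding sc bounded_iff
      by (intro exI[of _ "norm (d k) * S"]) (auto simp: norm_mult mult_left_mono)
  qed
  have "(\<lambda>k. M * (3/4::real) ^ (2 * k)) \<longlonglongrightarrow> 0"
    unfolding power_mult by (intro tendsto_mult_right_zero LIMSEQ_power_zero) (auto simp: power2_eq_square)
  then have "?e \<longlonglongrightarrow> norm (dilation \<alpha>) * 0 + norm (dilation \<alpha> - dilation \<alpha>) * R"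
    using d by (intro tendsto_intros)
  then have e: "?e \<longlonglongrightarrow> 0" by simp
  have "continuous_on K (\<lambda>z. to_plane (dilation \<alpha> * z))"
    unfolding to_plane_def by (intro continuous_intros)
  then have L: "compact ?L" "?L \<noteq> {}" using K compact_continuous_image by auto
  have lim: "(\<lambda>k. hausdist (scaled_curve i \<alpha> (mk i k)) ?L) \<longlonglongrightarrow> 0"
    by (rule tendsto_sandwich[OF _ _ tendsto_const e])
       (use hclose_imp_hausdist[OF close ne L(2)] in auto)
  have "(THE K. compact K \<and> K \<noteq> {} \<and> (\<lambda>k. hausdist (scaled_curve i \<alpha> (mk i k)) K) \<longlonglongrightarrow> 0) = ?L"
    (is "(THE K. ?P K) = _")
  proof (rule the_equality)
    show "?P ?L" using L lim by blast
    show "K' = ?L" if "?P K'" for K'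
      using hausdist_limit_unique[of "\<lambda>k. scaled_curve i \<alpha> (mk i k)" K' ?L, OF bd ne] that L lim by blast
  qed
  then show ?thesis unfolding fib_fractal_def using \<alpha> by simp
qed

lemma fib_fractal_tendsto:
  assumes fib: "\<And>k. fibw i (mk i k) = X (2 * k)"
  shows "((\<lambda>\<alpha>. hausdist (fib_fractal i \<alpha>) (fib_fractal i 0)) \<longlongrightarrow> 0) (at_right 0)"
proof -
  obtain p where p: "p > 0" "xlead 0 = of_real p" by (rule xlead_zero)
  let ?I = "closed_segment 0 (xlead 0)"
  have zero: "fib_fractal i 0 = (\<lambda>z. to_plane (dilation 0 * z)) ` ?I"
  proof -
    have "linear (\<lambda>z. to_plane (dilation 0 * z))"
      by (rule linearI) (auto simp: to_plane_def algebra_simps)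
    from closed_segment_linear_image[OF this, of 0 "xlead 0"] show ?thesis
      using p by (simp add: fib_fractal_def dilation_def to_plane_def)
  qed
  have seg: "norm z \<le> p" if "z \<in> ?I" for z
    using that p by (auto simp: closed_segment_def norm_mult mult_left_le_one_le)
  have nz: "xlead 0 \<noteq> 0" using p by simp
  have dil: "(dilation \<longlongrightarrow> dilation 0) (at_right 0)"
    unfolding dilation_def using nz
    by (intro tendsto_intros leads_tendsto_zero(1)) auto
  have "\<forall>\<^sub>F \<alpha> in at_right 0. xlead \<alpha> \<noteq> 0"
    using tendsto_imp_eventually_ne[OF leads_tendsto_zero(1) nz] .
  note ev = this eventually_growth eventually_at_right_less[of "0::real"]
  \<comment> \<open>An upper bound for \<open>norm (dilation \<alpha>)\<close> once
    \<open>dilation \<alpha>\<close> is within 1 of \<open>dilation 0\<close>. With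
    \<open>\<eta>\<close> below, the distance of the sets and the change of dilation each contribute
    at most \<open>e / 4\<close>.\<close>
  define D where "D = norm (dilation 0) + 1"
  have D: "D > 0" by (simp add: D_def add_nonneg_pos)
  show ?thesis
  proof (rule tendstoI)
    fix e :: real assume e: "e > 0"
    define \<eta> where "\<eta> = e / (4 * D)"
    have \<eta>: "\<eta> > 0" "D * \<eta> = e / 4" using e D by (auto simp: \<eta>_def)
    have "\<forall>\<^sub>F \<alpha> in at_right 0. dist (dilation \<alpha>) (dilation 0) < 1"
      "\<forall>\<^sub>F \<alpha> in at_right 0. dist (dilation \<alpha>) (dilation 0) < e / (4 * p)"
      using tendstoD[OF dil] e p(1) by simp_all
    with ev attractor_hclose_segment[OF \<eta>(1)]
    show "\<forall>\<^sub>F \<alpha> in at_right 0. dist (hausdist (fib_fractal i \<alpha>) (fib_fractal i 0)) 0 < e"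
    proof eventually_elim
      case (elim \<alpha>)
      obtain K M where K: "compact K" "K \<noteq> {}" "\<And>k. hclose (M * (3/4) ^ k) (nxset \<alpha> k) K"
        using attractor_exists[OF elim(2)] by blast
      have F: "fib_fractal i \<alpha> = (\<lambda>z. to_plane (dilation \<alpha> * z)) ` K"
        using elim by (intro fib_fractal_eq[OF fib elim(2) _ elim(1) K]) auto
      have "hclose \<eta> K ?I" using elim(4) K(3) by blast
      from to_plane_mult_hclose[OF this seg, of "dilation \<alpha>" "dilation 0"]
      have h: "hclose (norm (dilation \<alpha>) * \<eta> + norm (dilation \<alpha> - dilation 0) * p)
          (fib_fractal i \<alpha>) (fib_fractal i 0)" unfolding F zero .
      have "norm (dilation \<alpha>) \<le> D"
        using norm_triangle_ineq2[of "dilation \<alpha>" "dilation 0"] elim(5) by (simp add: D_def dist_norm)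
      then have "norm (dilation \<alpha>) * \<eta> \<le> e / 4"
        using mult_right_mono[of _ D \<eta>] \<eta> by fastforce
      moreover have "norm (dilation \<alpha> - dilation 0) * p \<le> e / 4"
        using elim(6) p(1) by (simp add: dist_norm field_simps)
      ultimately have "norm (dilation \<alpha>) * \<eta> + norm (dilation \<alpha> - dilation 0) * p < e"
        using e by linarith
      moreover have "fib_fractal i \<alpha> \<noteq> {}" "fib_fractal i 0 \<noteq> {}"
        using K(2) by (auto simp: F zero)
      ultimately show ?case using hclose_imp_hausdist[OF h] by (simp add: dist_real_def)
    qed
  qed
qed

end

section \<open>Initial words and the application to Fibonacci words\<close>

lemma turning_snoc: "turning (w @ [b]) = turning w + (if b = 0 then - ((-1) ^ length w) else 0)"
  unfolding turning_append by (simp add: heading_def uturn_def)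

lemma turning_replicate_zero: "turning (replicate n 0) = (if even n then 0 else -1)"
proof (induction n)
  case (Suc n)
  have "turning (replicate (Suc n) 0) = turning (replicate n 0 @ [0])"
    by (simp only: replicate_append_same[symmetric] replicate_Suc)
  then show ?case unfolding turning_snoc Suc by simp
qed simp

lemma fibw_append: "fibw i (n + 3) = fibw i (n + 2) @ fibw i (n + 1)"
  by (simp add: numeral_eq_Suc)

text \<open>Unfolding the Fibonacci rule over three indices gives both recursions; only parities and
  one turning remain as initial conditions.\<close>

lemma fibw_folded_words:
  assumes X0: "fibw i (n + 3) \<noteq> []" "even (length (fibw i (n + 3)))" "turning (fibw i (n + 3)) = 1"
    and Y0: "odd (length (fibw i (n + 2)))"
  shows "folded_words (\<lambda>k. fibw i (n + 3 + 3 * k)) (\<lambda>k. fibw i (n + 2 + 3 * k))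
    (turning (fibw i (n + 2)))"
proof
  fix k
  have f: "fibw i (n + 3 * k + j + 3) = fibw i (n + 3 * k + j + 2) @ fibw i (n + 3 * k + j + 1)" for j
    by (rule fibw_append)
  show "fibw i (n + 3 + 3 * Suc k) =
      fibw i (n + 2 + 3 * Suc k) @ fibw i (n + 3 + 3 * k) @ fibw i (n + 2 + 3 * k)"
    using f[of 3] f[of 1] by (simp add: algebra_simps numeral_eq_Suc)
  show "fibw i (n + 2 + 3 * Suc k) =
      fibw i (n + 3 + 3 * k) @ fibw i (n + 2 + 3 * k) @ fibw i (n + 3 + 3 * k)"
    using f[of 2] f[of 1] by (simp add: algebra_simps numeral_eq_Suc)
qed (use assms in auto)

theorem theorem5p11:
  fixes i :: nat
  assumes "i \<ge> 2"
  shows "((\<lambda>\<alpha>. hausdist (fib_fractal i \<alpha>) (fib_fractal i 0)) \<longlongrightarrow> 0)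
           (at_right 0)"
proof -
  \<comment> \<open>The generations start at index \<open>n + 3 = mk i 0\<close>, that is 5 or 3,
    where the word has even length and turning 1 and its predecessor has odd length.\<close>
  define n :: nat where "n = (if even i then 2 else 0)"
  have f2: "fibw i 2 = replicate (i - 1) 0 @ [1]" by (simp add: numeral_2_eq_2)
  have len: "length (fibw i 1) = 1" "length (fibw i 2) = i"
    unfolding f2 using assms by simp_all
  have "turning (fibw i 1) = -1" by (simp add: heading_def uturn_def)
  moreover have "turning (fibw i 2) = (if even i then -1 else 0)"
    unfolding f2 turning_snoc turning_replicate_zero using assms by simp
  ultimately have turn: "turning (fibw i 1) = -1" "turning (fibw i 2) = (if even i then -1 else 0)" .
  have f: "fibw i 3 = fibw i 2 @ fibw i 1" "fibw i 4 = fibw i 3 @ fibw i 2"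
      "fibw i 5 = fibw i 4 @ fibw i 3"
    by (simp_all add: numeral_eq_Suc)
  have len3: "length (fibw i 3) = i + 1" unfolding f(1) length_append len by simp
  have len4: "length (fibw i 4) = 2 * i + 1" unfolding f(2) length_append len len3 by simp
  have len5: "length (fibw i 5) = 3 * i + 2" unfolding f(3) length_append len3 len4 by simp
  have turn3: "turning (fibw i 3) = (if even i then -2 else 1)"
    unfolding f(1) turning_append unfolding turn unfolding len by simp
  have turn4: "turning (fibw i 4) = -1" if "even i"
    using that unfolding f(2) turning_append unfolding turn turn3 unfolding len3 by simp
  have turn5: "turning (fibw i 5) = 1" if "even i"
    using that unfolding f(3) turning_append unfolding turn3 turn4[OF that] unfolding len4 by simp
  have "folded_words (\<lambda>k. fibw i (n + 3 + 3 * k)) (\<lambda>k. fibw i (n + 2 + 3 * k))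
      (turning (fibw i (n + 2)))"
  proof (rule fibw_folded_words)
    show "even (length (fibw i (n + 3)))" "odd (length (fibw i (n + 2)))"
      by (simp_all add: n_def len len3 len4 len5)
    have "length (fibw i (n + 3)) > 0" by (simp add: n_def len3 len5 del: length_greater_0_conv)
    then show "fibw i (n + 3) \<noteq> []" by simp
    show "turning (fibw i (n + 3)) = 1"
      by (cases "even i") (auto simp: n_def turn3 turn5)
  qed
  then interpret folded_words "\<lambda>k. fibw i (n + 3 + 3 * k)" "\<lambda>k. fibw i (n + 2 + 3 * k)"
    "turning (fibw i (n + 2))" .
  show ?thesis
    by (rule fib_fractal_tendsto) (simp add: n_def mk_def add.commute)
qed

end
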